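(* Let $(U,\Sigma,\mu)$ be a $\sigma$-finite measure space with a full ordered core $\mathcal A$. Then the couple $(L^1_\mu,L^\infty_\mu\!\!\downarrow)$ has divisibility constant $1$.
   Context: Functions equal $\mu$-a.e. are identified. An ordered core of $(U,\Sigma,\mu)$ is a subset $\mathcal A\subseteq\Sigma$, totally ordered by inclusion, containing $\emptyset$, whose members all have finite $\mu$-measure. It is $\sigma$-bounded if $\bigcup\mathcal A=\bigcup\mathcal A_0$ for some countable $\mathcal A_0\subseteq\mathcal A$, and full if it is $\sigma$-bounded and $\bigcup\mathcal A=U$. $\sigma(\mathcal A)$ is the $\sigma$-ring generated by $\mathcal A$ (a $\sigma$-algebra on $U$ when $\mathcal A$ is full). Write $u\le_{\mathcal A}v$ if for all $A\in\mathcal A$, $v\in A$ implies $u\in A$. $L^\downarrow(\mathcal A)$ is the set of core decreasing functions: $\sigma(\mathcal A)$-measurable $f:U\to[0,\infty]$ with $f(u)\ge f(v)$ whenever $u\le_{\mathcal A}v$. $L^\infty_\mu\!\!\downarrow$ is the Banach space of $\Sigma$-measurable $f:U\to[-\infty,\infty]$ for which $\|f\|_{L^\infty_\mu\!\downarrow}=\sup\{\int_U|f|g\,d\mu:g\in L^1_\mu\cap L^\downarrow(\mathcal A),\ \|g\|_{L^1_\mu}\le1\}$ is finite. For a compatible couple $(X_0,X_1)$ of Banach spaces, $K(f,t;X_0,X_1)=\inf\{\|f_0\|_{X_0}+t\|f_1\|_{X_1}:f_0+f_1=f\}$ for $f\in X_0+X_1$, $t\ge0$, and $\|f\|_{X_0+X_1}=K(f,1;X_0,X_1)$.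 The couple has divisibility constant $1$ if for all $f\in X_0+X_1$ and all nonnegative, concave functions $\omega_j$ ($j=1,2,\dots$) on $[0,\infty)$, the conditions $\sum_{j=1}^\infty\omega_j(1)<\infty$ and $K(f,t;X_0,X_1)\le\sum_{j=1}^\infty\omega_j(t)$ for all $t\ge0$ imply that there exist $f_j\in X_0+X_1$ such that $K(f_j,t;X_0,X_1)\le\omega_j(t)$ for all $j$ and $t$, and $\sum_{j=1}^\infty f_j$ converges to $f$ in $X_0+X_1$. *)

theory Defs
  imports "HOL-Analysis.Analysis"
begin

section \<open>Ordered cores\<close>

definition ordered_core :: "'a measure \<Rightarrow> 'a set set \<Rightarrow> bool" where
  "ordered_core M \<A> \<longleftrightarrow>
     \<A> \<subseteq> sets M \<and> {} \<in> \<A> \<and>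
     (\<forall>A\<in>\<A>. \<forall>B\<in>\<A>. A \<subseteq> B \<or> B \<subseteq> A) \<and>
     (\<forall>A\<in>\<A>. emeasure M A < \<infinity>)"

definition sigma_bounded :: "'a set set \<Rightarrow> bool" where
  "sigma_bounded \<A> \<longleftrightarrow> (\<exists>\<A>\<^sub>0\<subseteq>\<A>. countable \<A>\<^sub>0 \<and> \<Union>\<A> = \<Union>\<A>\<^sub>0)"

definition full_ordered_core :: "'a measure \<Rightarrow> 'a set set \<Rightarrow> bool" where
  "full_ordered_core M \<A> \<longleftrightarrow>
     ordered_core M \<A> \<and> sigma_bounded \<A> \<and> \<Union>\<A> = space M"

inductive_set sigma_ring :: "'a set set \<Rightarrow> 'a set set" for \<A> :: "'a set set" where
  Basic: "A \<in> \<A> \<Longrightarrow> A \<in> sigma_ring \<A>"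
| Empty: "{} \<in> sigma_ring \<A>"
| Difference: "A \<in> sigma_ring \<A> \<Longrightarrow> B \<in> sigma_ring \<A> \<Longrightarrow> A - B \<in> sigma_ring \<A>"
| Union: "(\<And>i::nat. A i \<in> sigma_ring \<A>) \<Longrightarrow> (\<Union>i. A i) \<in> sigma_ring \<A>"

definition core_le :: "'a set set \<Rightarrow> 'a \<Rightarrow> 'a \<Rightarrow> bool" where
  "core_le \<A> u v \<longleftrightarrow> (\<forall>A\<in>\<A>. v \<in> A \<longrightarrow> u \<in> A)"

text \<open>Measurability with respect to a \<open>\<sigma>\<close>-ring is taken in the usual sense that preimages of
  Borel sets not containing \<open>0\<close> belong to the \<open>\<sigma>\<close>-ring. For a full core this is measurability
  with respect to the \<open>\<sigma>\<close>-algebra generated by the core, see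
  \<open>sigma_ring_measurable_iff\<close> below.\<close>

definition sigma_ring_measurable :: "'a measure \<Rightarrow> 'a set set \<Rightarrow> ('a \<Rightarrow> ereal) \<Rightarrow> bool" where
  "sigma_ring_measurable M \<A> f \<longleftrightarrow>
     (\<forall>B\<in>sets borel. 0 \<notin> B \<longrightarrow> {u \<in> space M. f u \<in> B} \<in> sigma_ring \<A>)"

definition core_decreasing :: "'a measure \<Rightarrow> 'a set set \<Rightarrow> ('a \<Rightarrow> ereal) set" where
  "core_decreasing M \<A> =
     {f. sigma_ring_measurable M \<A> f \<and> (\<forall>u\<in>space M. 0 \<le> f u) \<and>
         (\<forall>u\<in>space M. \<forall>v\<in>space M. core_le \<A> u v \<longrightarrow> f v \<le> f u)}"

lemma sigma_ring_eq_sigma_sets: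
  assumes "full_ordered_core M \<A>"
  shows "sigma_ring \<A> = sigma_sets (space M) \<A>"
proof -
  have sub: "\<A> \<subseteq> Pow (space M)"
    using assms unfolding full_ordered_core_def by blast
  obtain \<A>0 where a0: "\<A>0 \<subseteq> \<A>" "countable \<A>0" "\<Union>\<A>0 = space M"
    using assms unfolding full_ordered_core_def sigma_bounded_def by auto
  have empty: "{} \<in> \<A>"
    using assms unfolding full_ordered_core_def ordered_core_def by blast
  have space: "space M \<in> sigma_ring \<A>"
  proof -
    let ?r = "from_nat_into (insert {} \<A>0)"
    have r: "range ?r = insert {} \<A>0"
      using a0(2) by (intro range_from_nat_into) auto
    have "?r i \<in> sigma_ring \<A>" for i
      using r a0(1) empty by (metis Basic insert_iff rangeI subsetD)
    then have "(\<Union>i. ?r i) \<in> sigma_ring \<A>" by (rule sigma_ring.Union)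
    then show ?thesis using r a0(3) by simp
  qed
  show ?thesis
  proof (intro equalityI subsetI)
    fix X assume "X \<in> sigma_ring \<A>"
    then show "X \<in> sigma_sets (space M) \<A>"
    proof induction
      case (Difference A B)
      interpret sigma_algebra "space M" "sigma_sets (space M) \<A>"
        by (rule sigma_algebra_sigma_sets[OF sub])
      show ?case using Difference.IH by auto
    qed (auto intro: sigma_sets.intros)
  next
    fix X assume "X \<in> sigma_sets (space M) \<A>"
    then show "X \<in> sigma_ring \<A>"
      by induction (auto intro: sigma_ring.intros space)
  qed
qed

lemma sigma_ring_measurable_iff:
  assumes "full_ordered_core M \<A>"
  shows "sigma_ring_measurable M \<A> f \<longleftrightarrow> f \<in> borel_measurable (sigma (space M) \<A>)"
proof -
  let ?S = "sigma_sets (space M) \<A>"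
  have sub: "\<A> \<subseteq> Pow (space M)"
    using assms unfolding full_ordered_core_def by blast
  interpret sigma_algebra "space M" ?S
    by (rule sigma_algebra_sigma_sets[OF sub])
  have vimage: "f -` B \<inter> space M = {u \<in> space M. f u \<in> B}" for B by auto
  have "{u \<in> space M. f u \<in> B} \<in> ?S"
    if *: "sigma_ring_measurable M \<A> f" and B: "B \<in> sets borel" for B
  proof (cases "0 \<in> B")
    case True
    have "- B \<in> sets borel" using B by (metis borel_comp)
    then have "{u \<in> space M. f u \<in> - B} \<in> ?S"
      using * True unfolding sigma_ring_measurable_def sigma_ring_eq_sigma_sets[OF assms] by blast
    then have "space M - {u \<in> space M. f u \<in> - B} \<in> ?S" by blast
    moreover have "space M - {u \<in> space M. f u \<in> - B} = {u \<in> space M. f u \<in> B}" by auto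
    ultimately show ?thesis by simp
  next
    case False
    then show ?thesis
      using * B unfolding sigma_ring_measurable_def sigma_ring_eq_sigma_sets[OF assms] by blast
  qed
  then show ?thesis
    using sub by (auto simp: measurable_def vimage sigma_ring_measurable_def
        sigma_ring_eq_sigma_sets[OF assms])
qed

section \<open>The spaces\<close>

text \<open>Norms are extended-valued functionals on functions \<open>U \<rightarrow> [-\<infinity>,\<infinity>]\<close>; the associated space
  consists of the measurable functions of finite norm. Functions that agree almost everywhere
  are identified: the norms below depend only on almost everywhere classes, and all equations
  between functions are required almost everywhere only.\<close>

definition norm_space :: "'a measure \<Rightarrow> (('a \<Rightarrow> ereal) \<Rightarrow> ennreal) \<Rightarrow> ('a \<Rightarrow> ereal) set" where
  "norm_space M N = {f \<in> borel_measurable M. N f < \<infinity>}"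

definition L1_norm :: "'a measure \<Rightarrow> ('a \<Rightarrow> ereal) \<Rightarrow> ennreal" where
  "L1_norm M f = (\<integral>\<^sup>+u. e2ennreal \<bar>f u\<bar> \<partial>M)"

definition Linf_down_norm :: "'a measure \<Rightarrow> 'a set set \<Rightarrow> ('a \<Rightarrow> ereal) \<Rightarrow> ennreal" where
  "Linf_down_norm M \<A> f =
     (SUP g \<in> {g \<in> norm_space M (L1_norm M) \<inter> core_decreasing M \<A>. L1_norm M g \<le> 1}.
        \<integral>\<^sup>+u. e2ennreal (\<bar>f u\<bar> * g u) \<partial>M)"

section \<open>Couples\<close>

text \<open>A couple is given by two norms \<open>N0\<close>, \<open>N1\<close> on measurable functions. The sum \<open>f0 u + f1 u\<close>
  is only relevant for almost everywhere finite \<open>f0\<close>, \<open>f1\<close>; for a full core all members of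
  \<open>L\<^sup>1\<close> and of the space given by \<open>Linf_down_norm\<close> are of this kind, so the value of
  \<open>\<infinity> - \<infinity>\<close> plays no role.\<close>

definition decompositions ::
  "'a measure \<Rightarrow> (('a \<Rightarrow> ereal) \<Rightarrow> ennreal) \<Rightarrow> (('a \<Rightarrow> ereal) \<Rightarrow> ennreal) \<Rightarrow> ('a \<Rightarrow> ereal)
     \<Rightarrow> (('a \<Rightarrow> ereal) \<times> ('a \<Rightarrow> ereal)) set" where
  "decompositions M N0 N1 f =
     {(f0, f1). f0 \<in> norm_space M N0 \<and> f1 \<in> norm_space M N1 \<and> (AE u in M. f0 u + f1 u = f u)}"

definition sum_space ::
  "'a measure \<Rightarrow> (('a \<Rightarrow> ereal) \<Rightarrow> ennreal) \<Rightarrow> (('a \<Rightarrow> ereal) \<Rightarrow> ennreal) \<Rightarrow> ('a \<Rightarrow> ereal) set" where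
  "sum_space M N0 N1 = {f \<in> borel_measurable M. decompositions M N0 N1 f \<noteq> {}}"

text \<open>For \<open>f\<close> outside the sum space the infimum below is \<open>\<infinity>\<close>.\<close>

definition K_functional ::
  "'a measure \<Rightarrow> (('a \<Rightarrow> ereal) \<Rightarrow> ennreal) \<Rightarrow> (('a \<Rightarrow> ereal) \<Rightarrow> ennreal)
     \<Rightarrow> ('a \<Rightarrow> ereal) \<Rightarrow> real \<Rightarrow> ennreal" where
  "K_functional M N0 N1 f t =
     (INF (f0, f1) \<in> decompositions M N0 N1 f. N0 f0 + ennreal t * N1 f1)"

definition sum_norm ::
  "'a measure \<Rightarrow> (('a \<Rightarrow> ereal) \<Rightarrow> ennreal) \<Rightarrow> (('a \<Rightarrow> ereal) \<Rightarrow> ennreal)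
     \<Rightarrow> ('a \<Rightarrow> ereal) \<Rightarrow> ennreal" where
  "sum_norm M N0 N1 f = K_functional M N0 N1 f 1"

text \<open>For nonnegative concave \<open>\<omega> j\<close> on \<open>[0,\<infinity>)\<close>, one has \<open>\<omega> j t \<le> max 1 t * \<omega> j 1\<close>; hence
  summability at \<open>1\<close> makes the real series \<open>\<Sum>j. \<omega> j t\<close> convergent for every \<open>t \<ge> 0\<close>.\<close>

definition divisibility_constant_one ::
  "'a measure \<Rightarrow> (('a \<Rightarrow> ereal) \<Rightarrow> ennreal) \<Rightarrow> (('a \<Rightarrow> ereal) \<Rightarrow> ennreal) \<Rightarrow> bool" where
  "divisibility_constant_one M N0 N1 \<longleftrightarrow>
     (\<forall>f \<in> sum_space M N0 N1. \<forall>\<omega> :: nat \<Rightarrow> real \<Rightarrow> real.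
        (\<forall>j. concave_on {0..} (\<omega> j) \<and> (\<forall>t\<ge>0. 0 \<le> \<omega> j t)) \<longrightarrow>
        summable (\<lambda>j. \<omega> j 1) \<longrightarrow>
        (\<forall>t\<ge>0. K_functional M N0 N1 f t \<le> ennreal (\<Sum>j. \<omega> j t)) \<longrightarrow>
        (\<exists>F :: nat \<Rightarrow> 'a \<Rightarrow> ereal.
           (\<forall>j. F j \<in> sum_space M N0 N1) \<and>
           (\<forall>j. \<forall>t\<ge>0. K_functional M N0 N1 (F j) t \<le> ennreal (\<omega> j t)) \<and>
           (\<lambda>n. sum_norm M N0 N1 (\<lambda>u. f u - (\<Sum>j<n. F j u))) \<longlonglongrightarrow> 0))"

end

theory Submission
  imports Defs
begin

text \<open>The proof describes both sides of the divisibility property by the integrals of \<open>\<bar>f\<bar>\<close> over core sets.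

  On the one hand, \<open>\<integral>\<^sub>A \<bar>f\<bar> d\<mu> \<le> K(f, \<mu> A)\<close> for every core set \<open>A\<close>
  (\<open>nn_integral_core_le_K_functional\<close>). On the other hand, if \<open>w\<close> is nonnegative and concave and
  \<open>\<integral>\<^sub>A \<bar>g\<bar> d\<mu> \<le> w (\<mu> A)\<close> for every core set \<open>A\<close>, then \<open>K(g, t) \<le> w t\<close> for all \<open>t\<close>
  (\<open>K_functional_le_concave\<close>). So the task becomes: given \<open>\<integral>\<^sub>A \<bar>f\<bar> d\<mu> \<le> \<Sum>j. \<omega> j (\<mu> A)\<close> for all \<open>A\<close>, find
  a decomposition of \<open>f\<close> into multiples \<open>F j\<close> of itself with \<open>\<integral>\<^sub>A \<bar>F j\<bar> d\<mu> \<le> \<omega> j (\<mu> A)\<close>.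

  The core of the matter is the case of two summands (\<open>split_between_capacities\<close>): if
  \<open>\<integral>\<^sub>A g d\<mu> \<le> w0 (\<mu> A) + w1 (\<mu> A)\<close> with nondecreasing nonnegative \<open>w0\<close>, \<open>w1\<close>, then there is
  \<open>0 \<le> \<theta> \<le> 1\<close> such that \<open>\<theta> g\<close> obeys the bound \<open>w0\<close> and \<open>(1 - \<theta>) g\<close> the bound \<open>w1\<close>. This is a
  greedy assignment: while \<open>A\<close> moves up the chain, the mass of \<open>g\<close> goes to the second summand as long as
  that one has room, and the overflow goes to the first. The overflow is a nondecreasing function
  with Lipschitz constant \<open>1\<close> of the mass seen so far, and such a function has a density with values in
  \<open>[0, 1]\<close>, by the Radon--Nikodym theorem on the line (\<open>chain_density\<close>).

  The splitting is used twice. With \<open>w0\<close> constant and \<open>w1\<close> linear, taken from a supporting line of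
  \<open>w\<close>, it yields the decompositions behind \<open>K_functional_le_concave\<close>. With \<open>w0 = \<omega> n\<close>
  and \<open>w1\<close> the tail \<open>\<Sum>j > n. \<omega> j\<close>, it is iterated to produce the summands \<open>F n\<close>. What remains of \<open>f\<close> after
  \<open>n\<close> steps has integrals bounded by the tail of the series, so its norm in the sum space is at most
  the tail at \<open>1\<close> and tends to \<open>0\<close>.

  The link between norms and integrals over core sets is the fact that the norm dual to core
  decreasing functions is controlled by core sets alone (\<open>Linf_down_norm_le\<close>). It holds since superlevel
  sets of core decreasing functions agree almost everywhere with countable unions or intersections
  of core sets (\<open>down_set_density_le\<close>).\<close>

section \<open>Measures along chains of sets\<close>

text \<open>Finite unions of members of a chain are members again, so a countable union is the increasing limit
  of members. This carries every bound that is known on the core over to countable unions of core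
  sets, in particular to the whole space.\<close>

lemma chain_UN_emeasure_le:
  fixes B :: "nat \<Rightarrow> 'a set"
  assumes sets: "\<And>n. B n \<in> sets M"
    and chain: "\<And>m n. B m \<subseteq> B n \<or> B n \<subseteq> B m"
    and le: "\<And>n. emeasure M (B n) \<le> c"
  shows "emeasure M (\<Union>n. B n) \<le> c"
proof -
  have max: "\<exists>k. (\<Union>i\<le>n. B i) = B k" for n
  proof (induction n)
    case (Suc n)
    then obtain k where "(\<Union>i\<le>n. B i) = B k" by blast
    then have "(\<Union>i\<le>Suc n. B i) = B k \<union> B (Suc n)" by (auto simp: atMost_Suc)
    then show ?case using chain[of k "Suc n"] by (metis Un_absorb1 Un_absorb2)
  qed auto
  have "emeasure M (\<Union>n. \<Union>i\<le>n. B i) = (SUP n. emeasure M (\<Union>i\<le>n. B i))"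
    using sets by (intro SUP_emeasure_incseq[symmetric]) (auto simp: incseq_def intro: order_trans)
  also have "\<dots> \<le> c"
    using max le by (intro SUP_least) metis
  also have "(\<Union>n. \<Union>i\<le>n. B i) = (\<Union>n. B n)" by auto
  finally show ?thesis .
qed

lemma chain_INT_emeasure_ge:
  fixes B :: "nat \<Rightarrow> 'a set"
  assumes sets: "\<And>n. B n \<in> sets M"
    and chain: "\<And>m n. B m \<subseteq> B n \<or> B n \<subseteq> B m"
    and ge: "\<And>n. c \<le> emeasure M (B n)" and fin: "\<And>n. emeasure M (B n) < \<infinity>"
  shows "c \<le> emeasure M (\<Inter>n. B n)"
proof -
  have min: "\<exists>k. (\<Inter>i\<le>n. B i) = B k" for n
  proof (induction n)
    case (Suc n)
    then obtain k where "(\<Inter>i\<le>n. B i) = B k" by blast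
    then have "(\<Inter>i\<le>Suc n. B i) = B k \<inter> B (Suc n)" by (auto simp: atMost_Suc)
    then show ?case using chain[of k "Suc n"] by (metis Int_absorb1 Int_absorb2)
  qed auto
  have "c \<le> (INF n. emeasure M (\<Inter>i\<le>n. B i))"
    using min ge by (intro INF_greatest) metis
  also have "\<dots> = emeasure M (\<Inter>n. \<Inter>i\<le>n. B i)"
  proof (rule INF_emeasure_decseq)
    show "range (\<lambda>n. \<Inter>i\<le>n. B i) \<subseteq> sets M" using min sets by (metis image_subsetI)
    show "decseq (\<lambda>n. \<Inter>i\<le>n. B i)" by (auto simp: decseq_def)
    show "emeasure M (\<Inter>i\<le>n. B i) \<noteq> \<infinity>" for n using min fin by (metis less_irrefl)
  qed
  also have "(\<Inter>n. \<Inter>i\<le>n. B i) = (\<Inter>n. B n)" by auto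
  finally show ?thesis .
qed

section \<open>Densities with prescribed integrals over a chain\<close>

text \<open>Radon--Nikodym theorem on the line for distribution functions. If the increments of \<open>F\<close> are between
  \<open>0\<close> and those of \<open>N x = P {..x}\<close>, then \<open>F\<close> and \<open>N - F\<close> are both distribution functions, and their
  Stieltjes measures add up to \<open>P\<close>. Each of the two is therefore absolutely continuous with respect to
  \<open>P\<close>, and their densities have sum \<open>1\<close> almost everywhere, which is why the density of
  \<open>F\<close> can be taken at most \<open>1\<close>.\<close>

lemma stieltjes_density:
  fixes P :: "real measure" and F :: "real \<Rightarrow> real"
  assumes sets[measurable_cong, simp]: "sets P = sets borel"
    and fin: "\<And>x. emeasure P {..x} < \<infinity>"
    and mono: "\<And>x y. x \<le> y \<Longrightarrow> F x \<le> F y"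
    and lip: "\<And>x y. x \<le> y \<Longrightarrow> F y - F x \<le> measure P {..y} - measure P {..x}"
  obtains k :: "real \<Rightarrow> real" where "k \<in> borel_measurable borel" "\<And>x. 0 \<le> k x" "\<And>x. k x \<le> 1"
    "\<And>a b. a \<le> b \<Longrightarrow> (\<integral>\<^sup>+x. ennreal (k x) * indicator {a<..b} x \<partial>P) = ennreal (F b - F a)"
proof -
  define N where "N x = measure P {..x}" for x
  have Ioc_subset: "{x<..y} \<subseteq> {..y}" for x y :: real by auto
  have fin': "emeasure P {x<..y} \<noteq> \<infinity>" for x y
    using emeasure_mono[of "{x<..y}" "{..y}" P] fin[of y] Ioc_subset by (auto simp: top_unique)
  have N_diff: "N y - N x = measure P {x<..y}" if "x \<le> y" for x y
  proof -
    have "{..y} = {..x} \<union> {x<..y}" using that by auto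
    moreover have "measure P ({..x} \<union> {x<..y}) = measure P {..x} + measure P {x<..y}"
      using fin[of x] fin' by (intro measure_Union) auto
    ultimately have "N y = measure P {..x} + measure P {x<..y}"
      by (simp add: N_def)
    then show ?thesis by (simp add: N_def)
  qed
  have N_mono: "N x \<le> N y" if "x \<le> y" for x y
    using N_diff[OF that] measure_nonneg[of P "{x<..y}"] by linarith
  have N_rc: "continuous (at_right a) N" for a
    unfolding continuous_within
  proof (rule tendsto_at_right_sequentially[where b="a + 1"])
    fix f :: "nat \<Rightarrow> real" assume f: "decseq f" "f \<longlonglongrightarrow> a"
    then have "(\<lambda>n. N (f n)) \<longlonglongrightarrow> measure P (\<Inter>i. {.. f i})"
      unfolding N_def using fin by (intro Lim_measure_decseq) (auto simp: decseq_def less_top)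
    also have "(\<Inter>i. {.. f i}) = {.. a}"
      using decseq_ge[OF f] by (auto intro: order_trans LIMSEQ_le_const[OF f(2)])
    finally show "(\<lambda>n. N (f n)) \<longlonglongrightarrow> N a" by (simp add: N_def)
  qed simp
  have rc: "continuous (at_right a) G"
    if "\<And>x y. x \<le> y \<Longrightarrow> G x \<le> G y" "\<And>x y. x \<le> y \<Longrightarrow> G y - G x \<le> N y - N x" for a and G :: "real \<Rightarrow> real"
    unfolding continuous_within
  proof (rule real_tendsto_sandwich)
    show "\<forall>\<^sub>F x in at_right a. G a \<le> G x"
      using that(1) by (auto simp: eventually_at_filter intro: always_eventually)
    show "\<forall>\<^sub>F x in at_right a. G x \<le> G a + (N x - N a)"
      using that(2)[of a] by (auto simp: eventually_at_filter algebra_simps intro!: always_eventually dest: less_imp_le)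
    have "((\<lambda>x. G a + (N x - N a)) \<longlongrightarrow> G a + (N a - N a)) (at_right a)"
      using N_rc[of a] by (intro tendsto_intros) (simp add: continuous_within)
    then show "((\<lambda>x. G a + (N x - N a)) \<longlongrightarrow> G a) (at_right a)" by simp
  qed simp
  define H where "H x = N x - F x" for x
  have H_mono: "H x \<le> H y" if "x \<le> y" for x y
    using lip[OF that] by (simp add: H_def N_def)
  have H_lip: "H y - H x \<le> N y - N x" if "x \<le> y" for x y
    using mono[OF that] by (simp add: H_def)
  have F_lip: "F y - F x \<le> N y - N x" if "x \<le> y" for x y
    using lip[OF that] by (simp add: N_def)
  let ?S = "interval_measure F" and ?T = "interval_measure H"
  define Q where "Q = measure_of UNIV (sets borel) (\<lambda>E. emeasure ?S E + emeasure ?T E)"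
  have setsQ[simp]: "sets Q = sets borel"
    unfolding Q_def using sets.sigma_sets_eq[of "borel :: real measure"]
    by (simp add: sets_measure_of_conv)
  have Q: "emeasure Q E = emeasure ?S E + emeasure ?T E" if "E \<in> sets borel" for E
  proof (rule emeasure_measure_of[OF Q_def])
    show "countably_additive (sets Q) (\<lambda>E. emeasure ?S E + emeasure ?T E)"
      by (auto simp: countably_additive_def suminf_add[symmetric] suminf_emeasure subset_eq)
  qed (use that in \<open>auto simp: positive_def\<close>)
  have S_Ioc: "emeasure ?S {a<..b} = ennreal (F b - F a)" if "a \<le> b" for a b
    by (intro emeasure_interval_measure_Ioc rc that mono F_lip)
  have T_Ioc: "emeasure ?T {a<..b} = ennreal (H b - H a)" if "a \<le> b" for a b
    by (intro emeasure_interval_measure_Ioc rc that H_mono H_lip)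
  have P_Ioc: "emeasure P {a<..b} = ennreal (N b - N a)" if "a \<le> b" for a b
    using N_diff[OF that] fin'[of a b] by (simp add: emeasure_eq_ennreal_measure)
  have Ioc_eq: "emeasure P {a<..b} = emeasure Q {a<..b}" for a b
  proof (cases "a \<le> b")
    case True
    then have "emeasure Q {a<..b} = ennreal ((F b - F a) + (H b - H a))"
      using mono[OF True] H_mono[OF True] by (simp add: Q S_Ioc T_Ioc ennreal_plus[symmetric] del: ennreal_plus)
    then show ?thesis using P_Ioc[OF True] by (simp add: H_def)
  qed simp
  have PQ: "P = Q"
  proof (rule measure_eqI_generator_eq[where E="range (\<lambda>(a, b). {a<..b::real})" and \<Omega>=UNIV
        and A="\<lambda>n. {- real n<..real n}"])
    show "Int_stable (range (\<lambda>(a, b). {a<..b::real}))"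
    proof (rule Int_stableI)
      fix X Y assume "X \<in> range (\<lambda>(a, b). {a<..b::real})" "Y \<in> range (\<lambda>(a, b). {a<..b::real})"
      then obtain a b c d where "X = {a<..b}" "Y = {c<..d}" by auto
      then have "X \<inter> Y = (\<lambda>(a, b). {a<..b}) (max a c, min b d)" by auto
      then show "X \<inter> Y \<in> range (\<lambda>(a, b). {a<..b::real})" by blast
    qed
    show "sets P = sigma_sets UNIV (range (\<lambda>(a, b). {a<..b::real}))"
      by (simp add: borel_sigma_sets_Ioc)
    show "sets Q = sigma_sets UNIV (range (\<lambda>(a, b). {a<..b::real}))"
      by (simp add: borel_sigma_sets_Ioc)
    show "(\<Union>n. {- real n<..real n}) = (UNIV :: real set)"
    proof safe
      fix x :: real
      obtain n where "\<bar>x\<bar> < real n" using reals_Archimedean2 by blast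
      then show "x \<in> (\<Union>n. {- real n<..real n})" by (intro UN_I[of n]) auto
    qed auto
    show "emeasure P {- real n<..real n} \<noteq> \<infinity>" for n
      by (rule fin')
  qed (auto simp: Ioc_eq)
  have le: "emeasure ?S E \<le> emeasure P E" if "E \<in> sets borel" for E
    unfolding PQ using Q[OF that] by simp
  have le': "emeasure ?T E \<le> emeasure P E" if "E \<in> sets borel" for E
    unfolding PQ using Q[OF that] by simp
  interpret P: sigma_finite_measure P
  proof (standard, intro exI[of _ "range (\<lambda>n::nat. {..real n})"] conjI)
    show "\<Union> (range (\<lambda>n::nat. {..real n})) = space P"
      using real_arch_simple by (auto simp: sets_eq_imp_space_eq[OF sets])
    show "\<forall>a\<in>range (\<lambda>n::nat. {..real n}). emeasure P a \<noteq> \<infinity>"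
      using fin by (auto simp: less_top)
  qed auto
  have "absolutely_continuous P ?S"
    unfolding absolutely_continuous_def null_sets_def using le by fastforce
  then obtain f where f[measurable]: "f \<in> borel_measurable P" and fS: "density P f = ?S"
    using P.Radon_Nikodym[of ?S] by auto
  have "absolutely_continuous P ?T"
    unfolding absolutely_continuous_def null_sets_def using le' by fastforce
  then obtain g where g[measurable]: "g \<in> borel_measurable P" and gT: "density P g = ?T"
    using P.Radon_Nikodym[of ?T] by auto
  have "density P (\<lambda>x. f x + g x) = density P (\<lambda>x. 1)"
  proof (rule measure_eqI)
    fix E assume "E \<in> sets (density P (\<lambda>x. f x + g x))"
    then have E[measurable]: "E \<in> sets P" by simp
    have "emeasure (density P (\<lambda>x. f x + g x)) E = emeasure ?S E + emeasure ?T E"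
      unfolding fS[symmetric] gT[symmetric]
      using E by (simp add: emeasure_density distrib_right del: sets) (rule nn_integral_add; measurable)
    also have "\<dots> = emeasure (density P (\<lambda>x. 1)) E"
      using E by (simp add: emeasure_density PQ Q)
    finally show "emeasure (density P (\<lambda>x. f x + g x)) E = emeasure (density P (\<lambda>x. 1)) E" .
  qed simp
  then have "AE x in P. f x + g x = 1"
    by (intro P.density_unique) auto
  then have f1: "AE x in P. f x \<le> 1"
    by eventually_elim (metis add.right_neutral add_left_mono zero_le)
  define k where "k x = enn2real (min 1 (f x))" for x
  have kf: "ennreal (k x) = min 1 (f x)" for x
    unfolding k_def using le_less_trans[OF min.cobounded1 ennreal_one_less_top, of "f x"]
    by (intro ennreal_enn2real)
  show thesis
  proof
    have "f \<in> borel_measurable borel" using f measurable_cong_sets[OF sets refl] by blast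
    then show "k \<in> borel_measurable borel" unfolding k_def by measurable
    show "0 \<le> k x" for x by (simp add: k_def)
    show "k x \<le> 1" for x
    proof -
      have "ennreal (k x) \<le> 1" unfolding kf by simp
      then show ?thesis by simp
    qed
    fix a b :: real assume "a \<le> b"
    have "(\<integral>\<^sup>+x. ennreal (k x) * indicator {a<..b} x \<partial>P) = (\<integral>\<^sup>+x. f x * indicator {a<..b} x \<partial>P)"
      using f1 by (intro nn_integral_cong_AE) (auto simp: kf min_def)
    also have "\<dots> = emeasure ?S {a<..b}"
      unfolding fS[symmetric] by (simp add: emeasure_density)
    finally show "(\<integral>\<^sup>+x. ennreal (k x) * indicator {a<..b} x \<partial>P) = ennreal (F b - F a)"
      using S_Ioc[OF \<open>a \<le> b\<close>] by simp
  qed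
qed

text \<open>A nondecreasing function \<open>\<tau>\<close> with Lipschitz constant \<open>1\<close> assigns to \<open>A \<in> \<A>\<close> a mass \<open>\<tau> (\<mu> A)\<close> whose
  increments along the chain are dominated by those of \<open>\<mu>\<close>; such a mass distribution has a density
  with values in \<open>[0, 1]\<close>. The chain is moved to the real line by \<open>\<phi> u = inf {\<mu> B | u \<in> B}\<close>: up to
  null sets a member \<open>A\<close> is \<open>{u. \<phi> u \<le> \<mu> A}\<close>, because the set on the right contains \<open>A\<close> and
  has at most the same measure. On the line the Stieltjes version applies. Measurability of \<open>\<phi>\<close>
  requires a countable chain, so \<open>B\<close> runs only through a countable subfamily with measures dense in
  those of \<open>\<A>\<close>; the remaining members follow since both sides of the claim are Lipschitz
  in \<open>\<mu> A\<close>.\<close>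

lemma chain_density:
  fixes M :: "'a measure" and \<tau> :: "real \<Rightarrow> real"
  assumes sets: "\<A> \<subseteq> sets M" and empty: "{} \<in> \<A>"
    and chain: "\<And>A B. A \<in> \<A> \<Longrightarrow> B \<in> \<A> \<Longrightarrow> A \<subseteq> B \<or> B \<subseteq> A"
    and fin: "\<And>A. A \<in> \<A> \<Longrightarrow> emeasure M A < \<infinity>"
    and cover: "countable \<A>\<^sub>0" "\<A>\<^sub>0 \<subseteq> \<A>" "\<Union>\<A>\<^sub>0 = space M"
    and mono: "\<And>x y. 0 \<le> x \<Longrightarrow> x \<le> y \<Longrightarrow> \<tau> x \<le> \<tau> y"
    and lip: "\<And>x y. 0 \<le> x \<Longrightarrow> x \<le> y \<Longrightarrow> \<tau> y - \<tau> x \<le> y - x"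
    and zero: "\<tau> 0 = 0"
  obtains \<theta> :: "'a \<Rightarrow> real" where "\<theta> \<in> borel_measurable M" "\<And>u. 0 \<le> \<theta> u" "\<And>u. \<theta> u \<le> 1"
    "\<And>A. A \<in> \<A> \<Longrightarrow> (\<integral>\<^sup>+u. ennreal (\<theta> u) * indicator A u \<partial>M) = ennreal (\<tau> (measure M A))"
proof -
  obtain T where T: "countable T" "T \<subseteq> measure M ` \<A>" "measure M ` \<A> \<subseteq> closure T"
    using separable[of "measure M ` \<A>"] by blast
  have em: "emeasure M A = ennreal (measure M A)" if "A \<in> \<A>" for A
    using fin[OF that] by (simp add: emeasure_eq_ennreal_measure)
  define B where "B = from_nat_into (insert {} (\<A>\<^sub>0 \<union> inv_into \<A> (measure M) ` T))"
  have rangeB: "range B = insert {} (\<A>\<^sub>0 \<union> inv_into \<A> (measure M) ` T)"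
    unfolding B_def using cover(1) T(1) by (intro range_from_nat_into) auto
  have "inv_into \<A> (measure M) ` T \<subseteq> \<A>"
    using T(2) by (auto simp: subset_iff intro: inv_into_into)
  then have "range B \<subseteq> \<A>"
    unfolding rangeB using empty cover(2) by simp
  then have BA: "B n \<in> \<A>" for n by (simp add: range_subsetD)
  have BM[measurable]: "B n \<in> sets M" for n using BA sets by blast
  have "\<Union>\<A>\<^sub>0 \<subseteq> (\<Union>n. B n)"
    unfolding rangeB by auto
  then have B_cover: "\<exists>n. u \<in> B n" if "u \<in> space M" for u
    using that cover(3) by auto
  have B_dense: "\<exists>n. \<bar>measure M (B n) - measure M A\<bar> < e" if "A \<in> \<A>" "e > 0" for A e
  proof -
    have "measure M A \<in> closure T" using T(3) that(1) by blast
    then obtain t where t: "t \<in> T" "dist t (measure M A) < e"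
      using \<open>e > 0\<close> by (auto simp: closure_approachable)
    then have "inv_into \<A> (measure M) t \<in> range B" unfolding rangeB by blast
    then obtain n where "B n = inv_into \<A> (measure M) t" by (metis rangeE)
    then have "measure M (B n) = t" using T(2) t(1) by (metis f_inv_into_f subsetD)
    then show ?thesis using t(2) by (auto simp: dist_real_def)
  qed
  define \<psi> where "\<psi> u = (INF n. if u \<in> B n then emeasure M (B n) else \<infinity>)" for u
  define \<phi> where "\<phi> u = enn2real (\<psi> u)" for u
  have [measurable]: "\<psi> \<in> borel_measurable M" unfolding \<psi>_def by measurable
  have [measurable]: "\<phi> \<in> borel_measurable M" unfolding \<phi>_def by measurable
  have \<psi>_le: "\<psi> u \<le> emeasure M (B n)" if "u \<in> B n" for u n
    unfolding \<psi>_def using that by (intro INF_lower2[of n]) auto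
  have \<psi>\<phi>: "\<psi> u = ennreal (\<phi> u)" if "u \<in> space M" for u
  proof -
    obtain n where "u \<in> B n" using B_cover \<open>u \<in> space M\<close> by blast
    then have "\<psi> u < \<infinity>" using \<psi>_le fin[OF BA[of n]] by (metis le_less_trans)
    then show ?thesis unfolding \<phi>_def by (simp add: ennreal_enn2real)
  qed
  have \<phi>0: "0 \<le> \<phi> u" for u by (simp add: \<phi>_def)
  have \<phi>_le: "\<phi> u \<le> measure M (B n)" if "u \<in> B n" for u n
  proof -
    have "u \<in> space M" using that BM sets.sets_into_space by blast
    then show ?thesis using \<psi>_le[OF that] \<psi>\<phi>[of u] em[OF BA[of n]] by simp
  qed
  have sub_le: "emeasure M {u \<in> space M. \<phi> u \<le> x} \<le> ennreal x" if x: "0 \<le> x" for x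
  proof (rule ennreal_le_epsilon)
    fix e :: real assume e: "0 < e"
    define C where "C n = (if emeasure M (B n) \<le> ennreal (x + e) then B n else {})" for n
    have "{u \<in> space M. \<phi> u \<le> x} \<subseteq> (\<Union>n. C n)"
    proof
      fix u assume "u \<in> {u \<in> space M. \<phi> u \<le> x}"
      then have "\<psi> u \<le> ennreal x" using \<psi>\<phi>[of u] by (simp add: ennreal_leI)
      also have "ennreal x < ennreal (x + e)" using x e by (simp add: ennreal_lessI)
      finally obtain n where "(if u \<in> B n then emeasure M (B n) else \<infinity>) < ennreal (x + e)"
        unfolding \<psi>_def INF_less_iff by blast
      then have "u \<in> C n" by (auto simp: C_def split: if_splits)
      then show "u \<in> (\<Union>n. C n)" by blast
    qed
    moreover have CM: "C n \<in> sets M" for n by (simp add: C_def)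
    ultimately have "emeasure M {u \<in> space M. \<phi> u \<le> x} \<le> emeasure M (\<Union>n. C n)"
      by (intro emeasure_mono) auto
    also have "\<dots> \<le> ennreal (x + e)"
    proof (rule chain_UN_emeasure_le[OF CM])
      show "C m \<subseteq> C n \<or> C n \<subseteq> C m" for m n
        using chain[OF BA[of m] BA[of n]] by (auto simp: C_def)
      show "emeasure M (C n) \<le> ennreal (x + e)" for n by (simp add: C_def)
    qed
    finally show "emeasure M {u \<in> space M. \<phi> u \<le> x} \<le> ennreal x + ennreal e"
      using x e by simp
  qed
  define P where "P = distr M borel \<phi>"
  have P: "emeasure P {..x} = emeasure M {u \<in> space M. \<phi> u \<le> x}" for x
    unfolding P_def by (subst emeasure_distr) (auto intro!: arg_cong[where f="emeasure M"])
  have P_fin: "emeasure P {..x} < \<infinity>" for x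
  proof -
    have "emeasure P {..x} \<le> emeasure P {..max 0 x}" by (intro emeasure_mono) (auto simp: P_def)
    also have "\<dots> \<le> ennreal (max 0 x)" unfolding P by (rule sub_le) simp
    finally show ?thesis by (auto simp: less_top[symmetric] top_unique)
  qed
  define N where "N x = measure P {..x}" for x
  have N_mono: "N x \<le> N y" if "x \<le> y" for x y
    unfolding N_def using that P_fin[of y] by (intro measure_mono_fmeasurable) (auto simp: P_def fmeasurable_def)
  have N0: "0 \<le> N x" for x by (simp add: N_def)
  have \<tau>N_mono: "\<tau> (N x) \<le> \<tau> (N y)" if "x \<le> y" for x y
    using N_mono[OF that] N0 mono by blast
  have \<tau>N_lip: "\<tau> (N y) - \<tau> (N x) \<le> measure P {..y} - measure P {..x}" if "x \<le> y" for x y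
    using N_mono[OF that] N0 lip unfolding N_def by blast
  have [simp]: "sets P = sets borel" by (simp add: P_def)
  obtain k :: "real \<Rightarrow> real" where [measurable]: "k \<in> borel_measurable borel"
    and k01: "\<And>x. 0 \<le> k x" "\<And>x. k x \<le> 1"
    and k: "\<And>a b. a \<le> b \<Longrightarrow>
      (\<integral>\<^sup>+x. ennreal (k x) * indicator {a<..b} x \<partial>P) = ennreal (\<tau> (N b) - \<tau> (N a))"
    by (rule stieltjes_density[OF \<open>sets P = sets borel\<close> P_fin \<tau>N_mono \<tau>N_lip]) blast+
  define \<theta> where "\<theta> u = k (\<phi> u)" for u
  have [measurable]: "\<theta> \<in> borel_measurable M" unfolding \<theta>_def by measurable
  have \<theta>01: "0 \<le> \<theta> u" "\<theta> u \<le> 1" for u using k01 by (auto simp: \<theta>_def)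
  have B_eq: "(\<integral>\<^sup>+u. ennreal (\<theta> u) * indicator (B n) u \<partial>M) = ennreal (\<tau> (measure M (B n)))" for n
  proof -
    \<comment> \<open>All mass of \<open>P\<close> lies on \<open>{0..}\<close>, so the half-open interval \<open>{-1<..?a}\<close> can stand for \<open>{..?a}\<close>.\<close>
    let ?a = "measure M (B n)"
    let ?E = "{u \<in> space M. \<phi> u \<le> ?a}"
    have sub: "B n \<subseteq> ?E" using \<phi>_le BM sets.sets_into_space by blast
    have le: "emeasure M ?E \<le> emeasure M (B n)" using sub_le[of ?a] em[OF BA[of n]] by simp
    have E_eq: "emeasure M ?E = emeasure M (B n)"
      by (rule antisym[OF le emeasure_mono[OF sub]]) measurable
    have "emeasure M (?E - B n) = 0"
      using E_eq fin[OF BA[of n]] sub by (subst emeasure_Diff) auto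
    then have "?E - B n \<in> null_sets M" by (auto simp: null_sets_def)
    then have AE1: "AE u in M. u \<in> B n \<longleftrightarrow> \<phi> u \<le> ?a"
      using sub by (auto dest!: AE_not_in)
    have Na: "N ?a = ?a" unfolding N_def using P[of ?a] E_eq by (simp add: measure_def)
    have "{u \<in> space M. \<phi> u \<le> - 1} = {}" using order_trans[OF \<phi>0, of _ "-1"] by auto
    then have N1: "N (- 1) = 0"
      unfolding N_def using P[of "-1"] by (simp only: measure_def emeasure_empty) simp
    have "(\<integral>\<^sup>+u. ennreal (\<theta> u) * indicator (B n) u \<partial>M)
        = (\<integral>\<^sup>+u. ennreal (k (\<phi> u)) * indicator {-1<..?a} (\<phi> u) \<partial>M)"
      using AE1 \<phi>0 by (intro nn_integral_cong_AE)
        (auto simp: \<theta>_def indicator_def intro: less_le_trans[of "-1" 0] elim!: eventually_mono)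
    also have "\<dots> = (\<integral>\<^sup>+x. ennreal (k x) * indicator {-1<..?a} x \<partial>P)"
      unfolding P_def by (subst nn_integral_distr) auto
    also have "\<dots> = ennreal (\<tau> ?a)"
      by (subst k) (auto simp: Na N1 zero intro: order_trans[of _ 0])
    finally show ?thesis .
  qed
  \<comment> \<open>From the sets \<open>B n\<close> to all of \<open>\<A>\<close>: on the chain \<open>D\<close> varies no faster than the measure itself.\<close>
  define D where "D = density M \<theta>"
  have D: "emeasure D A = (\<integral>\<^sup>+u. ennreal (\<theta> u) * indicator A u \<partial>M)" if "A \<in> sets M" for A
    unfolding D_def using that by (subst emeasure_density) auto
  have D_le: "emeasure D A \<le> emeasure M A" if "A \<in> sets M" for A
  proof -
    have "emeasure D A \<le> (\<integral>\<^sup>+u. 1 * indicator A u \<partial>M)"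
      unfolding D[OF that] using \<theta>01 by (intro nn_integral_mono mult_right_mono) auto
    then show ?thesis using that by simp
  qed
  have D_fin: "emeasure D A \<noteq> \<infinity>" if "A \<in> \<A>" for A
    using D_le[of A] fin[OF that] sets that by (auto simp: top_unique)
  have D_diff: "\<bar>measure D A - measure D A'\<bar> \<le> \<bar>measure M A - measure M A'\<bar>"
    if "A \<in> \<A>" "A' \<in> \<A>" for A A'
  proof -
    have *: "0 \<le> measure D Y - measure D X \<and> measure D Y - measure D X \<le> measure M Y - measure M X"
      if XY: "X \<in> \<A>" "Y \<in> \<A>" "X \<subseteq> Y" for X Y
    proof -
      have m: "X \<in> sets M" "Y \<in> sets M" using XY sets by auto
      have "measure D Y - measure D X = measure D (Y - X)"
        using m XY D_fin by (subst measure_Diff) (auto simp: D_def)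
      moreover have "measure D (Y - X) \<le> measure M (Y - X)"
      proof -
        have "emeasure M (Y - X) < \<infinity>"
          using fin[OF XY(2)] m by (meson Diff_subset emeasure_mono le_less_trans)
        then show ?thesis using D_le[of "Y - X"] m unfolding measure_def
          by (intro enn2real_mono) auto
      qed
      moreover have "measure M (Y - X) = measure M Y - measure M X"
        using m XY fin by (subst measure_Diff) (auto simp: less_top)
      ultimately show ?thesis using measure_nonneg[of D "Y - X"] by linarith
    qed
    show ?thesis using chain[OF that] *[OF that] *[OF that(2,1)] by auto
  qed
  have \<tau>_diff: "\<bar>\<tau> x - \<tau> y\<bar> \<le> \<bar>x - y\<bar>" if "0 \<le> x" "0 \<le> y" for x y
    using that mono[of x y] mono[of y x] lip[of x y] lip[of y x] by (cases "x \<le> y") auto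
  have \<tau>0: "0 \<le> \<tau> x" if "0 \<le> x" for x using mono[of 0 x] zero that by simp
  show thesis
  proof
    fix A assume A: "A \<in> \<A>"
    have "\<bar>measure D A - \<tau> (measure M A)\<bar> \<le> 0 + e" if "e > 0" for e
    proof -
      obtain n where n: "\<bar>measure M (B n) - measure M A\<bar> < e / 2"
        using B_dense[OF A, of "e/2"] \<open>e > 0\<close> by auto
      have "measure D (B n) = \<tau> (measure M (B n))"
        using B_eq[of n] D[OF BM[of n]] \<tau>0[OF measure_nonneg, of M "B n"]
        by (simp add: measure_def[of D])
      then show ?thesis
        using n D_diff[OF A BA[of n]] \<tau>_diff[OF measure_nonneg measure_nonneg, of M "B n" M A] by linarith
    qed
    then have "measure D A = \<tau> (measure M A)" using field_le_epsilon[of _ 0] by force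
    then have "emeasure D A = ennreal (\<tau> (measure M A))"
      using D_fin[OF A] by (simp add: emeasure_eq_ennreal_measure)
    then show "(\<integral>\<^sup>+u. ennreal (\<theta> u) * indicator A u \<partial>M) = ennreal (\<tau> (measure M A))"
      using D[of A] A sets by auto
  qed (use \<theta>01 in auto)
qed

section \<open>Full ordered cores\<close>

lemma full_ordered_coreD:
  assumes "full_ordered_core M \<A>"
  shows "\<A> \<subseteq> sets M" "{} \<in> \<A>"
    and "\<And>A B. A \<in> \<A> \<Longrightarrow> B \<in> \<A> \<Longrightarrow> A \<subseteq> B \<or> B \<subseteq> A"
    and "\<And>A. A \<in> \<A> \<Longrightarrow> emeasure M A < \<infinity>"
proof -
  have core: "ordered_core M \<A>" using assms by (simp add: full_ordered_core_def)
  then show "\<A> \<subseteq> sets M" "{} \<in> \<A>" using core by (simp_all add: ordered_core_def)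
  show "A \<subseteq> B \<or> B \<subseteq> A" if "A \<in> \<A>" "B \<in> \<A>" for A B
    using core that by (simp add: ordered_core_def)
  show "emeasure M A < \<infinity>" if "A \<in> \<A>" for A
    using core that by (simp add: ordered_core_def)
qed

lemma full_ordered_core_enumerate:
  assumes "full_ordered_core M \<A>"
  obtains B :: "nat \<Rightarrow> 'a set" where "\<And>n. B n \<in> \<A>" "(\<Union>n. B n) = space M"
proof -
  obtain \<A>\<^sub>0 where \<A>\<^sub>0: "countable \<A>\<^sub>0" "\<A>\<^sub>0 \<subseteq> \<A>" "\<Union>\<A>\<^sub>0 = space M"
    using assms unfolding full_ordered_core_def sigma_bounded_def by metis
  \<comment> \<open>The empty set is added because an enumeration needs a nonempty range.\<close>
  have range: "range (from_nat_into (insert {} \<A>\<^sub>0)) = insert {} \<A>\<^sub>0"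
    using \<A>\<^sub>0(1) by (intro range_from_nat_into) auto
  have "insert {} \<A>\<^sub>0 \<subseteq> \<A>"
    using \<A>\<^sub>0(2) full_ordered_coreD(2)[OF assms] by simp
  then have "from_nat_into (insert {} \<A>\<^sub>0) n \<in> \<A>" for n
    using range by (metis rangeI subsetD)
  moreover have "(\<Union>n. from_nat_into (insert {} \<A>\<^sub>0) n) = space M"
    unfolding range using \<A>\<^sub>0(3) by simp
  ultimately show thesis by (rule that)
qed

lemma full_ordered_core_measure_mono:
  assumes "full_ordered_core M \<A>" "A \<in> \<A>" "B \<in> \<A>" "A \<subseteq> B"
  shows "measure M A \<le> measure M B"
proof (rule measure_mono_fmeasurable[OF assms(4)])
  show "A \<in> sets M" using full_ordered_coreD(1)[OF assms(1)] assms(2) by blast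
  show "B \<in> fmeasurable M"
    using full_ordered_coreD(1)[OF assms(1)] full_ordered_coreD(4)[OF assms(1) assms(3)] assms(3)
    by (intro fmeasurableI) auto
qed

text \<open>Countably many core sets cover the space.\<close>

lemma AE_finite_if_core_integrals_finite:
  assumes core: "full_ordered_core M \<A>" and q[measurable]: "q \<in> borel_measurable M"
    and fin: "\<And>A. A \<in> \<A> \<Longrightarrow> (\<integral>\<^sup>+u. q u * indicator A u \<partial>M) < \<infinity>"
  shows "AE u in M. q u < (\<infinity>::ennreal)"
proof -
  obtain B :: "nat \<Rightarrow> 'a set" where BA: "\<And>n. B n \<in> \<A>" and UB: "(\<Union>n. B n) = space M"
    by (rule full_ordered_core_enumerate[OF core]) blast
  have "AE u in M. \<forall>n. q u * indicator (B n) u \<noteq> \<infinity>"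
    unfolding AE_all_countable
  proof
    fix n
    have [measurable]: "B n \<in> sets M" using full_ordered_coreD(1)[OF core] BA by blast
    show "AE u in M. q u * indicator (B n) u \<noteq> \<infinity>"
      using fin[OF BA[of n]] by (intro nn_integral_noteq_infinite) auto
  qed
  then show ?thesis
  proof (rule AE_mp, intro AE_I2 impI)
    fix u assume "u \<in> space M" and fin: "\<forall>n. q u * indicator (B n) u \<noteq> \<infinity>"
    then obtain n where "u \<in> B n" using UB by blast
    then show "q u < \<infinity>" using fin[rule_format, of n] by (simp add: less_top)
  qed
qed

section \<open>Splitting a function between two capacities\<close>

text \<open>Think of \<open>\<nu> A = \<integral>\<^sub>A g\<close> as goods that arrive while \<open>A\<close> moves up the core, and of \<open>w0\<close>, \<open>w1\<close> as
  the capacities, growing with \<open>\<mu> A\<close>, of two containers that together can hold what has arrived so far.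
  Sending to the first container only what would otherwise overflow the second one respects both
  capacities: the first receives the largest excess \<open>\<nu> B - w1 (\<mu> B)\<close> over the \<open>B \<subseteq> A\<close>, and that excess
  is at most \<open>w0 (\<mu> B) \<le> w0 (\<mu> A)\<close>. The supremum \<open>\<tau> s\<close> of \<open>max 0 (min (\<nu> B) s - w1 (\<mu> B))\<close> over all \<open>B\<close>
  expresses this running excess as a function of \<open>s = \<nu> A\<close>: for \<open>B\<close> larger than \<open>A\<close> the term is at most
  the one for \<open>B = A\<close>, since \<open>w1\<close> is nondecreasing. In this form it is visibly nondecreasing with
  Lipschitz constant \<open>1\<close>. So it has a density \<open>\<theta>\<close> along the core.\<close>

lemma split_between_capacities:
  fixes M :: "'a measure" and g :: "'a \<Rightarrow> ennreal" and w0 w1 :: "real \<Rightarrow> real"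
  assumes core: "full_ordered_core M \<A>" and g[measurable]: "g \<in> borel_measurable M"
    and w0: "\<And>x y. 0 \<le> x \<Longrightarrow> x \<le> y \<Longrightarrow> w0 x \<le> w0 y" "\<And>x. 0 \<le> x \<Longrightarrow> 0 \<le> w0 x"
    and w1: "\<And>x y. 0 \<le> x \<Longrightarrow> x \<le> y \<Longrightarrow> w1 x \<le> w1 y" "\<And>x. 0 \<le> x \<Longrightarrow> 0 \<le> w1 x"
    and le: "\<And>A. A \<in> \<A> \<Longrightarrow>
      (\<integral>\<^sup>+u. g u * indicator A u \<partial>M) \<le> ennreal (w0 (measure M A) + w1 (measure M A))"
  obtains \<theta> :: "'a \<Rightarrow> real" where "\<theta> \<in> borel_measurable M" "\<And>u. 0 \<le> \<theta> u" "\<And>u. \<theta> u \<le> 1"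
    "\<And>A. A \<in> \<A> \<Longrightarrow>
      (\<integral>\<^sup>+u. ennreal (\<theta> u) * g u * indicator A u \<partial>M) \<le> ennreal (w0 (measure M A))"
    "\<And>A. A \<in> \<A> \<Longrightarrow>
      (\<integral>\<^sup>+u. ennreal (1 - \<theta> u) * g u * indicator A u \<partial>M) \<le> ennreal (w1 (measure M A))"
proof -
  note coreD = full_ordered_coreD[OF core]
  have AM: "A \<in> sets M" if "A \<in> \<A>" for A using coreD(1) that by blast
  define \<nu> where "\<nu> = density M g"
  have sets\<nu>[simp, measurable_cong]: "sets \<nu> = sets M" and space\<nu>[simp]: "space \<nu> = space M"
    by (simp_all add: \<nu>_def)
  have \<nu>: "emeasure \<nu> A = (\<integral>\<^sup>+u. g u * indicator A u \<partial>M)" if "A \<in> \<A>" for A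
    unfolding \<nu>_def using AM[OF that] by (simp add: emeasure_density)
  have \<nu>_fin: "emeasure \<nu> A < \<infinity>" if "A \<in> \<A>" for A
    unfolding \<nu>[OF that] using le_less_trans[OF le[OF that] ennreal_less_top] by simp
  have \<nu>_em: "emeasure \<nu> A = ennreal (measure \<nu> A)" if "A \<in> \<A>" for A
    using \<nu>_fin[OF that] by (simp add: emeasure_eq_ennreal_measure)
  have \<nu>_le: "measure \<nu> A \<le> w0 (measure M A) + w1 (measure M A)" if "A \<in> \<A>" for A
    using le[OF that] w0(2)[of "measure M A"] w1(2)[of "measure M A"]
    unfolding \<nu>[OF that, symmetric] \<nu>_em[OF that] by (subst (asm) ennreal_le_iff) auto
  define h where "h s B = max 0 (min (measure \<nu> B) s - w1 (measure M B))" for s B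
  define \<tau> where "\<tau> s = (SUP B\<in>\<A>. h s B)" for s
  have h_le: "h s B \<le> max 0 s" for s B
    using w1(2)[of "measure M B"] by (auto simp: h_def)
  have bdd: "bdd_above (h s ` \<A>)" for s
    using h_le by (intro bdd_aboveI2)
  have ne: "\<A> \<noteq> {}" using coreD(2) by blast
  have h_upper: "h s B \<le> \<tau> s" if "B \<in> \<A>" for s B
    unfolding \<tau>_def by (rule cSUP_upper[OF that bdd])
  have \<tau>_least: "\<tau> s \<le> c" if "\<And>B. B \<in> \<A> \<Longrightarrow> h s B \<le> c" for s c
    unfolding \<tau>_def using that by (rule cSUP_least[OF ne])
  have \<tau>_mono: "\<tau> x \<le> \<tau> y" if "x \<le> y" for x y
  proof (rule \<tau>_least)
    fix B assume "B \<in> \<A>"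
    have "h x B \<le> h y B" using that by (auto simp: h_def)
    then show "h x B \<le> \<tau> y" using h_upper[OF \<open>B \<in> \<A>\<close>, of y] by linarith
  qed
  have \<tau>_lip: "\<tau> y - \<tau> x \<le> y - x" if "x \<le> y" for x y
  proof -
    have "\<tau> y \<le> \<tau> x + (y - x)"
    proof (rule \<tau>_least)
      fix B assume "B \<in> \<A>"
      have "h y B \<le> h x B + (y - x)" using that by (auto simp: h_def)
      then show "h y B \<le> \<tau> x + (y - x)" using h_upper[OF \<open>B \<in> \<A>\<close>, of x] by linarith
    qed
    then show ?thesis by simp
  qed
  have \<tau>_zero: "\<tau> 0 = 0"
  proof (rule antisym)
    show "\<tau> 0 \<le> 0" by (rule \<tau>_least) (use h_le[of 0] in simp)
    have "0 \<le> h 0 {}" by (simp add: h_def)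
    then show "0 \<le> \<tau> 0" using h_upper[OF coreD(2), of 0] by linarith
  qed
  have \<tau>_le: "\<tau> (measure \<nu> A) \<le> w0 (measure M A)" if A: "A \<in> \<A>" for A
  proof (rule \<tau>_least)
    fix B assume B: "B \<in> \<A>"
    show "h (measure \<nu> A) B \<le> w0 (measure M A)"
    proof (cases "B \<subseteq> A")
      case True
      then have "w0 (measure M B) \<le> w0 (measure M A)"
        using full_ordered_core_measure_mono[OF core B A] w0(1) by simp
      then have "measure \<nu> B - w1 (measure M B) \<le> w0 (measure M A)" using \<nu>_le[OF B] by linarith
      then have "min (measure \<nu> B) (measure \<nu> A) - w1 (measure M B) \<le> w0 (measure M A)" by linarith
      then show ?thesis using w0(2)[of "measure M A"] unfolding h_def by simp
    next
      case False
      then have "A \<subseteq> B" using coreD(3)[OF A B] by blast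
      then have "w1 (measure M A) \<le> w1 (measure M B)"
        using full_ordered_core_measure_mono[OF core A B] w1(1) by simp
      then have "measure \<nu> A - w1 (measure M B) \<le> w0 (measure M A)" using \<nu>_le[OF A] by linarith
      then have "min (measure \<nu> B) (measure \<nu> A) - w1 (measure M B) \<le> w0 (measure M A)" by linarith
      then show ?thesis using w0(2)[of "measure M A"] unfolding h_def by simp
    qed
  qed
  have \<tau>_ge: "measure \<nu> A - w1 (measure M A) \<le> \<tau> (measure \<nu> A)" if A: "A \<in> \<A>" for A
    using h_upper[OF A, of "measure \<nu> A"] unfolding h_def by linarith
  obtain B :: "nat \<Rightarrow> 'a set" where B: "\<And>n. B n \<in> \<A>" "(\<Union>n. B n) = space M"
    by (rule full_ordered_core_enumerate[OF core]) blast
  have cover: "countable (range B)" "range B \<subseteq> \<A>" "\<Union>(range B) = space \<nu>"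
    using B by auto
  have sub: "\<A> \<subseteq> sets \<nu>" using coreD(1) by simp
  obtain \<theta> :: "'a \<Rightarrow> real" where \<theta>\<nu>: "\<theta> \<in> borel_measurable \<nu>"
    and \<theta>01: "\<And>u. 0 \<le> \<theta> u" "\<And>u. \<theta> u \<le> 1"
    and \<theta>: "\<And>A. A \<in> \<A> \<Longrightarrow> (\<integral>\<^sup>+u. ennreal (\<theta> u) * indicator A u \<partial>\<nu>) = ennreal (\<tau> (measure \<nu> A))"
    by (rule chain_density[OF sub coreD(2,3) \<nu>_fin cover \<tau>_mono \<tau>_lip \<tau>_zero]) blast+
  have [measurable]: "\<theta> \<in> borel_measurable M"
    using \<theta>\<nu> measurable_cong_sets[OF sets\<nu> refl] by blast
  have eq: "(\<integral>\<^sup>+u. ennreal (p u) * g u * indicator A u \<partial>M) = (\<integral>\<^sup>+u. ennreal (p u) * indicator A u \<partial>\<nu>)"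
    if "A \<in> \<A>" and [measurable]: "p \<in> borel_measurable M" for A and p :: "'a \<Rightarrow> real"
    unfolding \<nu>_def using AM[OF that(1)]
    by (subst nn_integral_density) (auto simp: ac_simps)
  show thesis
  proof
    fix A assume A: "A \<in> \<A>"
    show "(\<integral>\<^sup>+u. ennreal (\<theta> u) * g u * indicator A u \<partial>M) \<le> ennreal (w0 (measure M A))"
      unfolding eq[OF A \<open>\<theta> \<in> borel_measurable M\<close>] \<theta>[OF A] by (intro ennreal_leI \<tau>_le A)
    have [measurable]: "A \<in> sets \<nu>" using AM[OF A] by simp
    have "(\<integral>\<^sup>+u. ennreal (1 - \<theta> u) * indicator A u \<partial>\<nu>) + ennreal (\<tau> (measure \<nu> A))
        = (\<integral>\<^sup>+u. ennreal (1 - \<theta> u) * indicator A u + ennreal (\<theta> u) * indicator A u \<partial>\<nu>)"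
      unfolding \<theta>[OF A, symmetric] by (subst nn_integral_add) auto
    also have "\<dots> = (\<integral>\<^sup>+u. indicator A u \<partial>\<nu>)"
      using \<theta>01 by (intro nn_integral_cong)
        (auto simp: indicator_def ennreal_plus[symmetric] simp del: ennreal_plus)
    also have "\<dots> = ennreal (measure \<nu> A)"
      using \<nu>_em[OF A] by (subst nn_integral_indicator[OF \<open>A \<in> sets \<nu>\<close>])
    also have "\<dots> \<le> ennreal (w1 (measure M A) + \<tau> (measure \<nu> A))"
      using \<tau>_ge[OF A] by (intro ennreal_leI) simp
    also have "\<dots> = ennreal (w1 (measure M A)) + ennreal (\<tau> (measure \<nu> A))"
      using w1(2)[of "measure M A"] \<tau>_mono[of 0 "measure \<nu> A"] \<tau>_zero by (intro ennreal_plus) auto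
    finally have "ennreal (\<tau> (measure \<nu> A)) + (\<integral>\<^sup>+u. ennreal (1 - \<theta> u) * indicator A u \<partial>\<nu>)
        \<le> ennreal (\<tau> (measure \<nu> A)) + ennreal (w1 (measure M A))"
      by (simp only: add.commute)
    then have "(\<integral>\<^sup>+u. ennreal (1 - \<theta> u) * indicator A u \<partial>\<nu>) \<le> ennreal (w1 (measure M A))"
      unfolding ennreal_add_left_cancel_le by simp
    then show "(\<integral>\<^sup>+u. ennreal (1 - \<theta> u) * g u * indicator A u \<partial>M) \<le> ennreal (w1 (measure M A))"
      by (subst eq[OF A]) auto
  qed (use \<theta>01 in auto)
qed

section \<open>Nonnegative concave functions on the half-line\<close>

text \<open>If \<open>w\<close> decreased from \<open>x\<close> to \<open>y\<close>, then by concavity it would keep decreasing at least at that rate and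
  become negative.\<close>

lemma concave_nonneg_mono:
  fixes w :: "real \<Rightarrow> real"
  assumes conc: "concave_on {0..} w" and nonneg: "\<And>x. 0 \<le> x \<Longrightarrow> 0 \<le> w x"
    and xy: "0 \<le> x" "x \<le> y"
  shows "w x \<le> w y"
proof (rule ccontr)
  assume "\<not> w x \<le> w y"
  then have less: "w y < w x" by simp
  then have "x < y" using xy by (cases "x = y") auto
  \<comment> \<open>Continued beyond \<open>y\<close>, the chord through \<open>(x, w x)\<close> and \<open>(y, w y)\<close> takes the value \<open>-1\<close> at \<open>z\<close>.\<close>
  define z where "z = y + (y - x) * (w y + 1) / (w x - w y)"
  have wy: "0 \<le> w y" using nonneg xy by simp
  have yz: "y < z" using less \<open>x < y\<close> wy by (simp add: z_def)
  define l where "l = (y - x) / (z - x)"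
  have l: "0 < l" "l < 1" using \<open>x < y\<close> yz by (auto simp: l_def)
  have y: "(1 - l) * x + l * z = y"
  proof -
    have "l * (z - x) = y - x" using \<open>x < y\<close> yz by (simp add: l_def)
    then show ?thesis by (simp add: algebra_simps)
  qed
  have "(1 - l) * w x + l * w z \<le> w ((1 - l) *\<^sub>R x + l *\<^sub>R z)"
    using l xy yz \<open>x < y\<close> by (intro concave_onD[OF conc]) auto
  then have "(1 - l) * w x + l * w z \<le> w y" using y by simp
  then have "(1 - l) * w x \<le> w y" using nonneg[of z] xy yz l by (smt (verit) mult_nonneg_nonneg)
  then have "(z - y) * w x \<le> (z - x) * w y"
  proof -
    have "(1 - l) * (z - x) = z - y" "l * (z - x) = y - x" using \<open>x < y\<close> yz by (auto simp: l_def field_simps)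
    then show ?thesis
      using mult_right_mono[OF \<open>(1 - l) * w x \<le> w y\<close>, of "z - x"] \<open>x < y\<close> yz
      by (simp add: mult.commute mult.left_commute)
  qed
  then have "(z - y) * (w x - w y) \<le> (y - x) * w y" by (simp add: algebra_simps)
  moreover have "(z - y) * (w x - w y) = (y - x) * (w y + 1)" using less by (simp add: z_def)
  ultimately show False using \<open>x < y\<close> by (simp add: algebra_simps)
qed

text \<open>The slope is nonnegative because \<open>w\<close> is nondecreasing, and the intercept because it is at
  least \<open>w 0\<close>. At \<open>t = 0\<close> there need not be such a line, as \<open>w\<close> may jump or be infinitely steep there.\<close>

lemma concave_nonneg_supporting_line:
  fixes w :: "real \<Rightarrow> real"
  assumes conc: "concave_on {0..} w" and nonneg: "\<And>x. 0 \<le> x \<Longrightarrow> 0 \<le> w x" and t: "0 < t"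
  obtains a b where "0 \<le> a" "0 \<le> b" "a + b * t = w t" "\<And>x. 0 \<le> x \<Longrightarrow> w x \<le> a + b * x"
proof -
  have conv: "convex_on {0..} (\<lambda>x. - w x)" using conc by (simp add: concave_on_def)
  define b where "b = - Inf ((\<lambda>s. (- w t - - w s) / (t - s)) ` ({t<..} \<inter> {0..}))"
  have line: "w x \<le> w t + b * (x - t)" if "0 \<le> x" for x
    using convex_le_Inf_differential[OF conv, of t x] that t by (simp add: b_def)
  have "w t \<le> w (t + 1)" using t by (intro concave_nonneg_mono[OF conc nonneg]) auto
  then have b: "0 \<le> b" using line[of "t + 1"] t by simp
  have "0 \<le> w t - b * t" using line[of 0] nonneg[of 0] by simp
  then show thesis using b line by (intro that[of "w t - b * t" b]) (auto simp: algebra_simps)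
qed

lemma concave_nonneg_le_at_one:
  fixes w :: "real \<Rightarrow> real"
  assumes conc: "concave_on {0..} w" and nonneg: "\<And>x. 0 \<le> x \<Longrightarrow> 0 \<le> w x" and t: "0 \<le> t"
  shows "w t \<le> max 1 t * w 1"
proof (cases "t \<le> 1")
  case True
  then show ?thesis using concave_nonneg_mono[OF conc nonneg t True] by (simp add: max_def)
next
  case False
  then have t1: "1 < t" by simp
  \<comment> \<open>The point \<open>1\<close> lies between \<open>0\<close> and \<open>t\<close>.\<close>
  have "(1 - 1 / t) * w 0 + (1 / t) * w t \<le> w ((1 - 1 / t) *\<^sub>R 0 + (1 / t) *\<^sub>R t)"
    using t1 by (intro concave_onD[OF conc]) auto
  then have "(1 - 1 / t) * w 0 + w t / t \<le> w 1" using t1 by simp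
  moreover have "0 \<le> (1 - 1 / t) * w 0" using t1 nonneg[of 0] by simp
  ultimately have "w t / t \<le> w 1" by linarith
  then show ?thesis using t1 by (simp add: divide_le_eq mult.commute max_def)
qed

lemma summable_concave_nonneg:
  fixes \<omega> :: "nat \<Rightarrow> real \<Rightarrow> real"
  assumes conc: "\<And>j. concave_on {0..} (\<omega> j)" and nonneg: "\<And>j x. 0 \<le> x \<Longrightarrow> 0 \<le> \<omega> j x"
    and sum: "summable (\<lambda>j. \<omega> j 1)" and t: "0 \<le> t"
  shows "summable (\<lambda>j. \<omega> j t)"
proof (rule summable_comparison_test')
  show "summable (\<lambda>j. max 1 t * \<omega> j 1)" using sum by (rule summable_mult)
  show "norm (\<omega> j t) \<le> max 1 t * \<omega> j 1" for j
    using concave_nonneg_le_at_one[OF conc nonneg t] nonneg[OF t] by simp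
qed

lemma concave_on_suminf:
  fixes \<omega> :: "nat \<Rightarrow> real \<Rightarrow> real"
  assumes conc: "\<And>j. concave_on S (\<omega> j)" and sum: "\<And>x. x \<in> S \<Longrightarrow> summable (\<lambda>j. \<omega> j x)"
  shows "concave_on S (\<lambda>x. \<Sum>j. \<omega> j x)"
proof -
  have S: "convex S" using conc[of 0] by (simp add: concave_on_iff)
  show ?thesis
    unfolding concave_on_iff
  proof (intro conjI ballI allI impI S)
    fix x y u v :: real
    assume xy: "x \<in> S" "y \<in> S" and uv: "0 \<le> u" "0 \<le> v" "u + v = 1"
    have mem: "u *\<^sub>R x + v *\<^sub>R y \<in> S" using S xy uv by (rule convexD)
    have "u * (\<Sum>j. \<omega> j x) + v * (\<Sum>j. \<omega> j y) = (\<Sum>j. u * \<omega> j x + v * \<omega> j y)"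
      using sum xy by (simp add: suminf_add[symmetric] suminf_mult summable_mult)
    also have "\<dots> \<le> (\<Sum>j. \<omega> j (u *\<^sub>R x + v *\<^sub>R y))"
    proof (rule suminf_le)
      show "u * \<omega> j x + v * \<omega> j y \<le> \<omega> j (u *\<^sub>R x + v *\<^sub>R y)" for j
        using conc[of j] xy uv unfolding concave_on_iff by blast
    qed (use sum xy mem in \<open>auto intro: summable_add summable_mult\<close>)
    finally show "u * (\<Sum>j. \<omega> j x) + v * (\<Sum>j. \<omega> j y) \<le> (\<Sum>j. \<omega> j (u *\<^sub>R x + v *\<^sub>R y))" .
  qed
qed

section \<open>The norm dual to core decreasing functions\<close>

text \<open>The sets that essentially contain \<open>C\<close> or essentially avoid it form a \<open>\<sigma>\<close>-algebra.\<close>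

lemma sigma_sets_null_dichotomy:
  assumes sub: "\<A> \<subseteq> sets M" and C: "C \<in> sets M"
    and gen: "\<And>A. A \<in> \<A> \<Longrightarrow> A \<inter> C \<in> null_sets M \<or> C - A \<in> null_sets M"
    and E: "E \<in> sigma_sets (space M) \<A>"
  shows "E \<inter> C \<in> null_sets M \<or> C - E \<in> null_sets M"
  using E
proof induction
  case (Compl E)
  have "(space M - E) \<inter> C = C - E" "C - (space M - E) = E \<inter> C"
    using sets.sets_into_space[OF C] by auto
  then show ?case using Compl.IH by auto
next
  case (Union E)
  have E: "E i \<in> sets M" for i
    using Union.hyps sets.sigma_sets_subset[OF sub] by blast
  show ?case
  proof (cases "\<exists>i. C - E i \<in> null_sets M")
    case True
    then obtain i where "C - E i \<in> null_sets M" by blast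
    then have "C - (\<Union>i. E i) \<in> null_sets M"
      by (rule null_sets_subset) (use E C in auto)
    then show ?thesis by blast
  next
    case False
    then have "E i \<inter> C \<in> null_sets M" for i using Union.IH by blast
    then have "(\<Union>i. E i \<inter> C) \<in> null_sets M" by (rule null_sets_UN)
    moreover have "(\<Union>i. E i \<inter> C) = (\<Union>i. E i) \<inter> C" by blast
    ultimately show ?thesis by simp
  qed
qed (use gen in auto)

text \<open>If some \<open>v \<in> D\<close> lies outside \<open>A\<close>, then every core set that contains \<open>v\<close> contains \<open>A\<close>.
  So all points of \<open>A\<close> lie below \<open>v\<close> and belong to \<open>D\<close>.\<close>

lemma core_down_set_cases:
  assumes core: "full_ordered_core M \<A>" and A: "A \<in> \<A>"
    and D: "D \<subseteq> space M" and down: "\<And>u v. u \<in> space M \<Longrightarrow> v \<in> D \<Longrightarrow> core_le \<A> u v \<Longrightarrow> u \<in> D"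
  shows "A \<subseteq> D \<or> D \<subseteq> A"
proof (rule disjCI)
  assume "\<not> D \<subseteq> A"
  then obtain v where v: "v \<in> D" "v \<notin> A" by blast
  show "A \<subseteq> D"
  proof
    fix u assume u: "u \<in> A"
    have "core_le \<A> u v"
      unfolding core_le_def using full_ordered_coreD(3)[OF core A] v(2) u by blast
    moreover have "u \<in> space M" using full_ordered_coreD(1)[OF core] A u sets.sets_into_space by blast
    ultimately show "u \<in> D" using down v(1) by blast
  qed
qed

text \<open>A bound on core sets passes to measurable down-sets, since up to a null set every such \<open>D\<close> is the
  union of a sequence of core sets or the intersection of one. If \<open>D\<close> contains the whole core, it
  is the whole space. Otherwise take a maximizing sequence of core sets inside \<open>D\<close> with union \<open>lo\<close>,
  and a minimizing sequence of core sets around \<open>D\<close> with intersection \<open>hi\<close>. No core set divides the gap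
  \<open>hi - lo\<close> into two parts of positive measure. Hence no member of the generated \<open>\<sigma>\<close>-algebra does,
  in particular not \<open>D\<close>, so that \<open>D\<close> equals \<open>lo\<close> or \<open>hi\<close> up to
  a null set.\<close>

lemma down_set_density_le:
  fixes M :: "'a measure" and g :: "'a \<Rightarrow> ennreal"
  assumes core: "full_ordered_core M \<A>" and g[measurable]: "g \<in> borel_measurable M"
    and le: "\<And>A. A \<in> \<A> \<Longrightarrow> (\<integral>\<^sup>+u. g u * indicator A u \<partial>M) \<le> ennreal b * emeasure M A"
    and D: "D \<in> sigma_sets (space M) \<A>"
    and down: "\<And>u v. u \<in> space M \<Longrightarrow> v \<in> D \<Longrightarrow> core_le \<A> u v \<Longrightarrow> u \<in> D"
  shows "(\<integral>\<^sup>+u. g u * indicator D u \<partial>M) \<le> ennreal b * emeasure M D"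
proof -
  note coreD = full_ordered_coreD[OF core]
  have AM: "A \<in> sets M" if "A \<in> \<A>" for A using coreD(1) that by blast
  have DM[measurable]: "D \<in> sets M" using D sets.sigma_sets_subset[OF coreD(1)] by blast
  have comparable: "A \<subseteq> D \<or> D \<subseteq> A" if "A \<in> \<A>" for A
    by (rule core_down_set_cases[OF core that sets.sets_into_space[OF DM] down])
  define \<nu> where "\<nu> = density M g"
  have [simp]: "sets \<nu> = sets M" by (simp add: \<nu>_def)
  have \<nu>: "emeasure \<nu> X = (\<integral>\<^sup>+u. g u * indicator X u \<partial>M)" if "X \<in> sets M" for X
    unfolding \<nu>_def using that by (simp add: emeasure_density)
  have \<nu>_le: "emeasure \<nu> A \<le> ennreal b * emeasure M A" if "A \<in> \<A>" for A
    using le[OF that] \<nu>[OF AM[OF that]] by simp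
  \<comment> \<open>Extremal sequences are taken with respect to \<open>\<kappa> = M + \<nu>\<close>, so that gaps become null for both measures.\<close>
  define \<kappa> where "\<kappa> = density M (\<lambda>u. 1 + g u)"
  have sets\<kappa>[simp]: "sets \<kappa> = sets M" by (simp add: \<kappa>_def)
  have \<kappa>: "emeasure \<kappa> X = emeasure M X + emeasure \<nu> X" if "X \<in> sets M" for X
    unfolding \<nu>[OF that] \<kappa>_def using that
    by (simp add: emeasure_density distrib_right nn_integral_add)
  have \<kappa>_fin: "emeasure \<kappa> A < \<infinity>" if "A \<in> \<A>" for A
  proof -
    have "ennreal b * emeasure M A < \<infinity>" using coreD(4)[OF that] by (simp add: ennreal_mult_less_top)
    then show ?thesis
      unfolding \<kappa>[OF AM[OF that]] using coreD(4)[OF that] le_less_trans[OF \<nu>_le[OF that]] by simp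
  qed
  have \<kappa>_null: "emeasure M X = 0 \<and> emeasure \<nu> X = 0" if "X \<in> null_sets \<kappa>" for X
    using that \<kappa>[of X] by (auto simp: null_sets_def)
  define r where "r = measure \<kappa>"
  have r: "emeasure \<kappa> A = ennreal (r A)" if "A \<in> \<A>" for A
    unfolding r_def using \<kappa>_fin[OF that] by (simp add: emeasure_eq_ennreal_measure)
  have r_mono: "r A \<le> r B" if "A \<in> \<A>" "B \<in> \<A>" "A \<subseteq> B" for A B
    unfolding r_def using that AM \<kappa>_fin by (intro measure_mono_fmeasurable fmeasurableI) auto
  have null_diff: "X \<in> null_sets \<kappa>"
    if X: "X \<in> sets M" "\<And>n::nat. X \<subseteq> P n - Q n" and PQ: "\<And>n. P n \<in> \<A>" "\<And>n. Q n \<in> \<A>"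
      "\<And>n. r (P n) \<le> r (Q n) + 1 / real (Suc n)" for X and P Q :: "nat \<Rightarrow> 'a set"
  proof -
    have "emeasure \<kappa> X \<le> ennreal (1 / real (Suc n))" for n
    proof (cases "P n \<subseteq> Q n")
      case True
      then have "X = {}" using X(2)[of n] by blast
      then show ?thesis by simp
    next
      case False
      then have "Q n \<subseteq> P n" using coreD(3)[OF PQ(1,2)] by blast
      have "emeasure \<kappa> X \<le> emeasure \<kappa> (P n - Q n)"
        using X(2)[of n] AM PQ(1,2) by (intro emeasure_mono) auto
      also have "\<dots> = emeasure \<kappa> (P n) - emeasure \<kappa> (Q n)"
        using \<open>Q n \<subseteq> P n\<close> AM PQ(1,2) \<kappa>_fin[OF PQ(2)[of n]] by (intro emeasure_Diff) auto
      also have "\<dots> = ennreal (r (P n) - r (Q n))"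
        unfolding r[OF PQ(1)] r[OF PQ(2)] by (rule ennreal_minus) (simp add: r_def)
      also have "\<dots> \<le> ennreal (1 / real (Suc n))"
        using PQ(3)[of n] by (intro ennreal_leI) simp
      finally show ?thesis .
    qed
    moreover have "(\<lambda>n. ennreal (1 / real (Suc n))) \<longlonglongrightarrow> ennreal 0"
      by (intro tendsto_ennrealI LIMSEQ_Suc lim_const_over_n)
    ultimately have "emeasure \<kappa> X \<le> ennreal 0"
      by (intro LIMSEQ_le_const[of _ "ennreal 0" "emeasure \<kappa> X"]) auto
    then show ?thesis using X(1) by (auto simp: null_sets_def)
  qed
  have union: "emeasure \<nu> (\<Union>n. B n) \<le> ennreal b * emeasure M D"
    if B: "\<And>n. B n \<in> \<A>" "\<And>n. B n \<subseteq> D" for B :: "nat \<Rightarrow> 'a set"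
  proof (rule chain_UN_emeasure_le)
    show "emeasure \<nu> (B n) \<le> ennreal b * emeasure M D" for n
      using \<nu>_le[OF B(1)[of n]] emeasure_mono[OF B(2)[of n] DM]
      by (meson mult_left_mono order_trans zero_le)
  qed (use B AM coreD(3) in auto)
  have "emeasure \<nu> D \<le> ennreal b * emeasure M D"
  proof (cases "\<forall>A\<in>\<A>. A \<subseteq> D")
    case True
    obtain B :: "nat \<Rightarrow> 'a set" where BA: "\<And>n. B n \<in> \<A>" and UB: "(\<Union>n. B n) = space M"
      by (rule full_ordered_core_enumerate[OF core]) blast
    have "D \<subseteq> (\<Union>n. B n)"
      using sets.sets_into_space[OF DM] unfolding UB .
    then have "emeasure \<nu> D \<le> emeasure \<nu> (\<Union>n. B n)"
      using BA AM by (intro emeasure_mono) auto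
    then show ?thesis using union[of B] BA True by (meson order_trans)
  next
    case False
    then obtain A\<^sub>1 where A\<^sub>1: "A\<^sub>1 \<in> \<A>" "D \<subseteq> A\<^sub>1" using comparable by blast
    define L where "L = {A\<in>\<A>. A \<subseteq> D}"
    define H where "H = {A\<in>\<A>. D \<subseteq> A}"
    have L_ne: "L \<noteq> {}" and H_ne: "H \<noteq> {}" using coreD(2) A\<^sub>1 by (auto simp: L_def H_def)
    have L_bdd: "bdd_above (r ` L)"
      using A\<^sub>1 by (intro bdd_aboveI2[where M="r A\<^sub>1"] r_mono) (auto simp: L_def)
    have H_bdd: "bdd_below (r ` H)"
      by (intro bdd_belowI2[where m=0]) (simp add: r_def)
    have "\<exists>A\<in>L. (SUP A\<in>L. r A) - 1 / real (Suc n) < r A" for n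
      using less_cSUP_iff[OF L_ne L_bdd, of "(SUP A\<in>L. r A) - 1 / real (Suc n)"] by simp
    then obtain P where P: "P n \<in> L" "(SUP A\<in>L. r A) - 1 / real (Suc n) < r (P n)" for n by metis
    have "\<exists>A\<in>H. r A < (INF A\<in>H. r A) + 1 / real (Suc n)" for n
      using cINF_less_iff[OF H_ne H_bdd, of "(INF A\<in>H. r A) + 1 / real (Suc n)"] by simp
    then obtain Q where Q: "Q n \<in> H" "r (Q n) < (INF A\<in>H. r A) + 1 / real (Suc n)" for n by metis
    have PA: "P n \<in> \<A>" "P n \<subseteq> D" and QA: "Q n \<in> \<A>" "D \<subseteq> Q n" for n
      using P(1)[of n] Q(1)[of n] by (auto simp: L_def H_def)
    have [measurable]: "P n \<in> sets M" "Q n \<in> sets M" for n using PA QA AM by auto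
    define lo where "lo = (\<Union>n. P n)"
    define hi where "hi = (\<Inter>n. Q n)"
    have lo[measurable]: "lo \<in> sets M" and hi[measurable]: "hi \<in> sets M"
      unfolding lo_def hi_def by measurable
    have lo_D: "lo \<subseteq> D" unfolding lo_def using PA(2) by (rule UN_least)
    have D_hi: "D \<subseteq> hi" unfolding hi_def using QA(2) by (rule INT_greatest)
    have lo_null: "A - lo \<in> null_sets \<kappa>" if A: "A \<in> L" for A
    proof (rule null_diff[where P="\<lambda>_. A" and Q=P])
      show "r A \<le> r (P n) + 1 / real (Suc n)" for n
        using cSUP_upper[OF A L_bdd] P(2)[of n] by linarith
    qed (use A AM PA in \<open>auto simp: L_def lo_def\<close>)
    have hi_null: "hi - A \<in> null_sets \<kappa>" if A: "A \<in> H" for A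
    proof (rule null_diff[where P=Q and Q="\<lambda>_. A"])
      show "r (Q n) \<le> r A + 1 / real (Suc n)" for n
        using cINF_lower[OF H_bdd A] Q(2)[of n] by linarith
    qed (use A AM QA in \<open>auto simp: H_def hi_def\<close>)
    have "D \<inter> (hi - lo) \<in> null_sets \<kappa> \<or> (hi - lo) - D \<in> null_sets \<kappa>"
    proof (rule sigma_sets_null_dichotomy)
      show "D \<in> sigma_sets (space \<kappa>) \<A>" using D by (simp add: \<kappa>_def)
      fix A assume A: "A \<in> \<A>"
      show "A \<inter> (hi - lo) \<in> null_sets \<kappa> \<or> (hi - lo) - A \<in> null_sets \<kappa>"
      proof (cases "A \<subseteq> D")
        case True
        then have "A \<inter> (hi - lo) \<in> null_sets \<kappa>"
          using A AM lo hi by (intro null_sets_subset[OF lo_null[of A]]) (auto simp: L_def)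
        then show ?thesis ..
      next
        case False
        then have "D \<subseteq> A" using comparable[OF A] by blast
        then have "(hi - lo) - A \<in> null_sets \<kappa>"
          using A AM lo hi by (intro null_sets_subset[OF hi_null[of A]]) (auto simp: H_def)
        then show ?thesis ..
      qed
    qed (use coreD(1) lo hi in auto)
    then show ?thesis
    proof
      assume "D \<inter> (hi - lo) \<in> null_sets \<kappa>"
      then have "emeasure \<nu> (D \<inter> (hi - lo)) = 0" using \<kappa>_null by blast
      moreover have "D = lo \<union> (D \<inter> (hi - lo))" using lo_D D_hi by blast
      then have "emeasure \<nu> D \<le> emeasure \<nu> lo + emeasure \<nu> (D \<inter> (hi - lo))"
        using emeasure_subadditive[of lo \<nu> "D \<inter> (hi - lo)"] lo hi DM by simp
      ultimately have "emeasure \<nu> D \<le> emeasure \<nu> lo" by simp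
      also have "\<dots> \<le> ennreal b * emeasure M D" unfolding lo_def using PA by (rule union)
      finally show ?thesis .
    next
      assume "(hi - lo) - D \<in> null_sets \<kappa>"
      then have "emeasure M ((hi - lo) - D) = 0" using \<kappa>_null by blast
      moreover have "hi = D \<union> ((hi - lo) - D)" using lo_D D_hi by blast
      then have "emeasure M hi \<le> emeasure M D + emeasure M ((hi - lo) - D)"
        using emeasure_subadditive[of D M "(hi - lo) - D"] lo hi DM by simp
      ultimately have hi_le: "emeasure M hi \<le> emeasure M D" by simp
      \<comment> \<open>A measure with the values \<open>b * emeasure M X\<close>, to which continuity along chains applies.\<close>
      let ?S = "density M (\<lambda>_. ennreal b)"
      have S: "emeasure ?S X = ennreal b * emeasure M X" if "X \<in> sets M" for X
        using that by (rule emeasure_density_const)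
      have "emeasure \<nu> D \<le> emeasure ?S hi"
        unfolding hi_def
      proof (rule chain_INT_emeasure_ge)
        fix n
        have "emeasure \<nu> D \<le> emeasure \<nu> (Q n)"
          using QA[of n] AM by (intro emeasure_mono) auto
        then show "emeasure \<nu> D \<le> emeasure ?S (Q n)"
          using \<nu>_le[OF QA(1)[of n]] S[OF AM[OF QA(1)[of n]]] by simp
        show "emeasure ?S (Q n) < \<infinity>"
          using S[OF AM[OF QA(1)[of n]]] coreD(4)[OF QA(1)[of n]] by (simp add: ennreal_mult_less_top)
      qed (use QA AM coreD(3) in auto)
      also have "\<dots> \<le> ennreal b * emeasure M D"
        unfolding S[OF hi] using hi_le by (intro mult_left_mono) auto
      finally show ?thesis .
    qed
  qed
  then show ?thesis by (simp add: \<nu>)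
qed

lemma e2ennreal_mult:
  assumes "0 \<le> a" "0 \<le> b"
  shows "e2ennreal (a * b) = e2ennreal a * e2ennreal b"
proof -
  obtain x y where "a = enn2ereal x" "b = enn2ereal y"
    using assms by (meson ereal_ennreal_cases not_le)
  then show ?thesis by (metis e2ennreal_enn2ereal times_ennreal.rep_eq)
qed

lemma e2ennreal_abs_cmult:
  assumes "0 \<le> c"
  shows "e2ennreal \<bar>ereal c * x\<bar> = ennreal c * e2ennreal \<bar>x\<bar>"
proof -
  have "\<bar>ereal c * x\<bar> = ereal c * \<bar>x\<bar>"
    using assms by (cases x; cases "c = 0") (auto simp: abs_mult)
  then show ?thesis using assms by (simp add: e2ennreal_mult)
qed

lemma e2ennreal_abs_add_le:
  "e2ennreal \<bar>a + b\<bar> \<le> e2ennreal \<bar>a\<bar> + e2ennreal \<bar>b\<bar>"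
  by (cases a; cases b) (auto simp: ennreal_plus[symmetric] intro!: ennreal_leI simp del: ennreal_plus)

lemma nn_integral_indicator_below:
  fixes h :: ennreal
  shows "(\<integral>\<^sup>+s. indicator {s. 0 \<le> s \<and> ennreal s < h} s \<partial>lborel) = h"
proof (cases h)
  case (real c)
  have "{s. 0 \<le> s \<and> ennreal s < h} = {0..<c}"
    using real by (auto simp: ennreal_less_iff)
  then show ?thesis using real by simp
next
  case top
  have "{s. 0 \<le> s \<and> ennreal s < h} = {0..}" using top by auto
  moreover have "emeasure lborel {0::real..} = top"
  proof (rule ccontr)
    assume "emeasure lborel {0::real..} \<noteq> top"
    then obtain c where c: "0 \<le> c" "emeasure lborel {0::real..} = ennreal c"
      by (cases "emeasure lborel {0::real..}") auto
    have "emeasure lborel {0..c + 1} \<le> emeasure lborel {0::real..}"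
      by (intro emeasure_mono) auto
    then show False using c by (simp add: ennreal_le_iff)
  qed
  ultimately show ?thesis using top by simp
qed

text \<open>By the layer cake formula a core decreasing function is a superposition of indicators of its
  superlevel sets, which are measurable down-sets. Together with the next lemma this identifies the norm with
  the supremum of the averages of \<open>\<bar>f\<bar>\<close> over core sets of positive measure.\<close>

lemma Linf_down_norm_le:
  assumes sf: "sigma_finite_measure M" and core: "full_ordered_core M \<A>"
    and f[measurable]: "f \<in> borel_measurable M"
    and le: "\<And>A. A \<in> \<A> \<Longrightarrow>
      (\<integral>\<^sup>+u. e2ennreal \<bar>f u\<bar> * indicator A u \<partial>M) \<le> ennreal b * emeasure M A"
  shows "Linf_down_norm M \<A> f \<le> ennreal b"
  unfolding Linf_down_norm_def
proof (rule SUP_least)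
  fix g assume "g \<in> {g \<in> norm_space M (L1_norm M) \<inter> core_decreasing M \<A>. L1_norm M g \<le> 1}"
  then have g[measurable]: "g \<in> borel_measurable M" and g_norm: "L1_norm M g \<le> 1"
    and g_meas: "sigma_ring_measurable M \<A> g" and g_nonneg: "\<And>u. u \<in> space M \<Longrightarrow> 0 \<le> g u"
    and g_dec: "\<And>u v. u \<in> space M \<Longrightarrow> v \<in> space M \<Longrightarrow> core_le \<A> u v \<Longrightarrow> g v \<le> g u"
    by (auto simp: norm_space_def core_decreasing_def)
  interpret sigma_finite_measure M by fact
  interpret pair_sigma_finite M lborel ..
  define q where "q u = e2ennreal \<bar>f u\<bar>" for u
  define h where "h u = e2ennreal (g u)" for u
  have [measurable]: "q \<in> borel_measurable M" "h \<in> borel_measurable M"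
    unfolding q_def h_def by measurable
  have level: "(\<integral>\<^sup>+u. q u * indicator {u \<in> space M. ennreal s < h u} u \<partial>M)
      \<le> ennreal b * (\<integral>\<^sup>+u. indicator {u \<in> space M. ennreal s < h u} u \<partial>M)" if s: "0 \<le> s" for s
  proof -
    have D_eq: "{u \<in> space M. ennreal s < h u} = {u \<in> space M. g u \<in> {ereal s<..}}"
    proof -
      have "ennreal s < e2ennreal (g u) \<longleftrightarrow> ereal s < g u" if "u \<in> space M" for u
        using g_nonneg[OF that] s by (cases "g u") (auto simp: ennreal_less_iff)
      then show ?thesis by (auto simp: h_def)
    qed
    have "(\<integral>\<^sup>+u. q u * indicator {u \<in> space M. ennreal s < h u} u \<partial>M)
        \<le> ennreal b * emeasure M {u \<in> space M. ennreal s < h u}"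
    proof (rule down_set_density_le[OF core])
      show "(\<integral>\<^sup>+u. q u * indicator A u \<partial>M) \<le> ennreal b * emeasure M A" if "A \<in> \<A>" for A
        using le[OF that] by (simp add: q_def)
      have "{ereal s<..} \<in> sets borel" "0 \<notin> {ereal s<..}" using s by auto
      then show "{u \<in> space M. ennreal s < h u} \<in> sigma_sets (space M) \<A>"
        using g_meas unfolding D_eq sigma_ring_measurable_def sigma_ring_eq_sigma_sets[OF core] by blast
      show "u \<in> {u \<in> space M. ennreal s < h u}"
        if "u \<in> space M" "v \<in> {u \<in> space M. ennreal s < h u}" "core_le \<A> u v" for u v
        using that g_dec[of u v] unfolding D_eq by auto
    qed measurable
    then show ?thesis by simp
  qed
  have layers: "(\<integral>\<^sup>+u. p u * h u \<partial>M) =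
      (\<integral>\<^sup>+s. (\<integral>\<^sup>+u. p u * indicator {u \<in> space M. ennreal s < h u} u \<partial>M) * indicator {0..} s \<partial>lborel)"
    if [measurable]: "p \<in> borel_measurable M" for p
  proof -
    have "(\<integral>\<^sup>+u. p u * h u \<partial>M) =
        (\<integral>\<^sup>+u. (\<integral>\<^sup>+s. p u * indicator {s. 0 \<le> s \<and> ennreal s < h u} s \<partial>lborel) \<partial>M)"
      by (simp add: nn_integral_cmult nn_integral_indicator_below)
    also have "\<dots> = (\<integral>\<^sup>+s. (\<integral>\<^sup>+u. p u * indicator {s. 0 \<le> s \<and> ennreal s < h u} s \<partial>M) \<partial>lborel)"
      by (rule Fubini'[symmetric]) measurable
    also have "\<dots> = (\<integral>\<^sup>+s. (\<integral>\<^sup>+u. p u * indicator {u \<in> space M. ennreal s < h u} u * indicator {0..} s \<partial>M) \<partial>lborel)"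
      by (intro nn_integral_cong) (auto simp: indicator_def)
    also have "\<dots> = (\<integral>\<^sup>+s. (\<integral>\<^sup>+u. p u * indicator {u \<in> space M. ennreal s < h u} u \<partial>M) * indicator {0..} s \<partial>lborel)"
      by (intro nn_integral_cong nn_integral_multc) measurable
    finally show ?thesis .
  qed
  have "(\<integral>\<^sup>+u. e2ennreal (\<bar>f u\<bar> * g u) \<partial>M) = (\<integral>\<^sup>+u. q u * h u \<partial>M)"
    using g_nonneg by (intro nn_integral_cong) (auto simp: q_def h_def e2ennreal_mult)
  also have "\<dots> \<le> (\<integral>\<^sup>+u. ennreal b * h u \<partial>M)"
    unfolding layers[OF \<open>q \<in> borel_measurable M\<close>] layers[OF borel_measurable_const]
  proof (intro nn_integral_mono)
    fix s :: real
    show "(\<integral>\<^sup>+u. q u * indicator {u \<in> space M. ennreal s < h u} u \<partial>M) * indicator {0..} s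
      \<le> (\<integral>\<^sup>+u. ennreal b * indicator {u \<in> space M. ennreal s < h u} u \<partial>M) * indicator {0..} s"
      using level[of s] by (auto simp: indicator_def[of "{0..}"] nn_integral_cmult)
  qed
  also have "\<dots> = ennreal b * (\<integral>\<^sup>+u. h u \<partial>M)" by (rule nn_integral_cmult) measurable
  also have "(\<integral>\<^sup>+u. h u \<partial>M) = L1_norm M g"
    unfolding L1_norm_def h_def using g_nonneg by (intro nn_integral_cong) auto
  also have "ennreal b * L1_norm M g \<le> ennreal b" using mult_left_mono[OF g_norm, of "ennreal b"] by simp
  finally show "(\<integral>\<^sup>+u. e2ennreal (\<bar>f u\<bar> * g u) \<partial>M) \<le> ennreal b" .
qed

text \<open>The normalized indicator of \<open>A\<close> is an admissible test function in the definition of the norm.\<close>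

lemma nn_integral_core_le_Linf_down_norm:
  assumes core: "full_ordered_core M \<A>" and A: "A \<in> \<A>" and f[measurable]: "f \<in> borel_measurable M"
  shows "(\<integral>\<^sup>+u. e2ennreal \<bar>f u\<bar> * indicator A u \<partial>M) \<le> emeasure M A * Linf_down_norm M \<A> f"
proof -
  note coreD = full_ordered_coreD[OF core]
  have AM[measurable]: "A \<in> sets M" using coreD(1) A by blast
  define m where "m = measure M A"
  have m: "emeasure M A = ennreal m"
    unfolding m_def using coreD(4)[OF A] by (simp add: emeasure_eq_ennreal_measure)
  show ?thesis
  proof (cases "m = 0")
    case True
    then have "A \<in> null_sets M" using m by (simp add: null_sets_def)
    then show ?thesis by (simp add: nn_integral_null_set)
  next
    case False
    then have m_pos: "0 < m" by (simp add: m_def less_le)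
    define g where "g u = ereal (indicator A u / m)" for u
    have g_abs: "e2ennreal \<bar>g u\<bar> = ennreal (1 / m) * indicator A u" for u
      using m_pos by (auto simp: g_def indicator_def)
    have [measurable]: "g \<in> borel_measurable M" unfolding g_def by measurable
    have "L1_norm M g = ennreal (1 / m) * ennreal m"
      unfolding L1_norm_def g_abs m[symmetric] by (simp add: nn_integral_cmult)
    also have "\<dots> = 1" using m_pos by (simp add: ennreal_mult[symmetric])
    finally have g_norm: "L1_norm M g = 1" .
    have "g \<in> borel_measurable (sigma (space M) \<A>)"
    proof -
      have sub: "\<A> \<subseteq> Pow (space M)" using coreD(1) sets.sets_into_space by blast
      have [measurable]: "A \<in> sets (sigma (space M) \<A>)" using A sub by auto
      show ?thesis unfolding g_def by measurable
    qed
    then have "g \<in> core_decreasing M \<A>"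
      unfolding core_decreasing_def sigma_ring_measurable_iff[OF core]
      using A m_pos by (auto simp: g_def core_le_def indicator_def)
    then have "(\<integral>\<^sup>+u. e2ennreal (\<bar>f u\<bar> * g u) \<partial>M) \<le> Linf_down_norm M \<A> f"
      unfolding Linf_down_norm_def using g_norm by (intro SUP_upper) (auto simp: norm_space_def)
    moreover have "e2ennreal (\<bar>f u\<bar> * g u) = ennreal (1 / m) * (e2ennreal \<bar>f u\<bar> * indicator A u)" for u
    proof -
      have "0 \<le> g u" using m_pos by (simp add: g_def)
      then show ?thesis using g_abs[of u] by (simp add: e2ennreal_mult ac_simps)
    qed
    ultimately have "ennreal (1 / m) * (\<integral>\<^sup>+u. e2ennreal \<bar>f u\<bar> * indicator A u \<partial>M) \<le> Linf_down_norm M \<A> f"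
      by (simp add: nn_integral_cmult)
    then have "ennreal m * (ennreal (1 / m) * (\<integral>\<^sup>+u. e2ennreal \<bar>f u\<bar> * indicator A u \<partial>M))
        \<le> ennreal m * Linf_down_norm M \<A> f"
      by (rule mult_left_mono) simp
    moreover have "ennreal m * ennreal (1 / m) = 1" using m_pos by (simp add: ennreal_mult[symmetric])
    ultimately show ?thesis unfolding m by (simp add: mult.assoc[symmetric])
  qed
qed

section \<open>Two-sided bounds for the \<open>K\<close>-functional\<close>

lemma decompositionsD:
  assumes "(f0, f1) \<in> decompositions M (L1_norm M) (Linf_down_norm M \<A>) f"
  shows "f0 \<in> borel_measurable M" "L1_norm M f0 < \<infinity>"
    "f1 \<in> borel_measurable M" "Linf_down_norm M \<A> f1 < \<infinity>" "AE u in M. f0 u + f1 u = f u"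
  using assms by (auto simp: decompositions_def norm_space_def)

lemma K_functional_cong_AE:
  assumes "AE u in M. f u = g u"
  shows "K_functional M N0 N1 f t = K_functional M N0 N1 g t"
proof -
  have "(AE u in M. f0 u + f1 u = f u) \<longleftrightarrow> (AE u in M. f0 u + f1 u = g u)" for f0 f1
  proof
    assume "AE u in M. f0 u + f1 u = f u"
    then show "AE u in M. f0 u + f1 u = g u" using assms by eventually_elim simp
  next
    assume "AE u in M. f0 u + f1 u = g u"
    then show "AE u in M. f0 u + f1 u = f u" using assms by eventually_elim simp
  qed
  then have "decompositions M N0 N1 f = decompositions M N0 N1 g"
    by (simp add: decompositions_def)
  then show ?thesis by (simp add: K_functional_def)
qed

text \<open>For \<open>f = f0 + f1\<close>, the first part contributes at most its \<open>L\<^sup>1\<close> norm to the integral over \<open>A\<close>, and the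
  second at most \<open>\<mu> A\<close> times its norm.\<close>

lemma nn_integral_core_le_K_functional:
  assumes core: "full_ordered_core M \<A>" and A: "A \<in> \<A>"
  shows "(\<integral>\<^sup>+u. e2ennreal \<bar>f u\<bar> * indicator A u \<partial>M)
    \<le> K_functional M (L1_norm M) (Linf_down_norm M \<A>) f (measure M A)"
  unfolding K_functional_def
proof (rule INF_greatest, clarify)
  fix f0 f1 assume dec: "(f0, f1) \<in> decompositions M (L1_norm M) (Linf_down_norm M \<A>) f"
  note [measurable] = decompositionsD(1,3)[OF dec]
  have [measurable]: "A \<in> sets M" using full_ordered_coreD(1)[OF core] A by blast
  have "(\<integral>\<^sup>+u. e2ennreal \<bar>f u\<bar> * indicator A u \<partial>M)
      \<le> (\<integral>\<^sup>+u. e2ennreal \<bar>f0 u\<bar> * indicator A u + e2ennreal \<bar>f1 u\<bar> * indicator A u \<partial>M)"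
  proof (rule nn_integral_mono_AE)
    show "AE u in M. e2ennreal \<bar>f u\<bar> * indicator A u
        \<le> e2ennreal \<bar>f0 u\<bar> * indicator A u + e2ennreal \<bar>f1 u\<bar> * indicator A u"
      using decompositionsD(5)[OF dec]
    proof eventually_elim
      case (elim u)
      then show ?case
        using e2ennreal_abs_add_le[of "f0 u" "f1 u"] by (simp add: indicator_def)
    qed
  qed
  also have "\<dots> = (\<integral>\<^sup>+u. e2ennreal \<bar>f0 u\<bar> * indicator A u \<partial>M)
      + (\<integral>\<^sup>+u. e2ennreal \<bar>f1 u\<bar> * indicator A u \<partial>M)"
    by (rule nn_integral_add) measurable
  also have "(\<integral>\<^sup>+u. e2ennreal \<bar>f0 u\<bar> * indicator A u \<partial>M) \<le> L1_norm M f0"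
    unfolding L1_norm_def by (intro nn_integral_mono) (auto simp: indicator_def)
  also have "(\<integral>\<^sup>+u. e2ennreal \<bar>f1 u\<bar> * indicator A u \<partial>M)
      \<le> emeasure M A * Linf_down_norm M \<A> f1"
    by (rule nn_integral_core_le_Linf_down_norm[OF core A]) measurable
  also have "emeasure M A = ennreal (measure M A)"
    using full_ordered_coreD(4)[OF core A] by (simp add: emeasure_eq_ennreal_measure)
  finally show "(\<integral>\<^sup>+u. e2ennreal \<bar>f u\<bar> * indicator A u \<partial>M)
      \<le> L1_norm M f0 + ennreal (measure M A) * Linf_down_norm M \<A> f1"
    by (simp add: add_mono)
qed

text \<open>At \<open>t = 0\<close> only the \<open>L\<^sup>1\<close> norm of the first component counts. Moving the values of modulus at
  most \<open>n\<close> from that component to the other one raises the averages of the latter over core sets by at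
  most \<open>n\<close>, hence keeps its norm finite, and makes the \<open>L\<^sup>1\<close> norm that remains arbitrarily small for
  large \<open>n\<close>.\<close>

lemma K_functional_zero:
  assumes sf: "sigma_finite_measure M" and core: "full_ordered_core M \<A>"
    and f: "f \<in> sum_space M (L1_norm M) (Linf_down_norm M \<A>)"
  shows "K_functional M (L1_norm M) (Linf_down_norm M \<A>) f 0 = 0"
proof -
  obtain f0 f1 where dec: "(f0, f1) \<in> decompositions M (L1_norm M) (Linf_down_norm M \<A>) f"
    using f by (auto simp: sum_space_def)
  note [measurable] = decompositionsD(1,3)[OF dec]
  define q where "q u = e2ennreal \<bar>f0 u\<bar>" for u
  have q[measurable]: "q \<in> borel_measurable M" unfolding q_def by measurable
  have q_int: "(\<integral>\<^sup>+u. q u \<partial>M) < \<infinity>" using decompositionsD(2)[OF dec] by (simp add: L1_norm_def q_def)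
  define g0 where "g0 n u = (if of_nat n < q u then f0 u else 0)" for n :: nat and u
  define g1 where "g1 n u = (if of_nat n < q u then f1 u else f0 u + f1 u)" for n :: nat and u
  have [measurable]: "g0 n \<in> borel_measurable M" "g1 n \<in> borel_measurable M" for n
    unfolding g0_def g1_def by measurable
  have g0_abs: "e2ennreal \<bar>g0 n u\<bar> = q u * indicator {u. of_nat n < q u} u" for n u
    by (simp add: g0_def q_def e2ennreal_neg)
  have AE_fin: "AE u in M. q u \<noteq> \<infinity>"
    using q_int by (intro nn_integral_noteq_infinite) auto
  have lim: "(\<lambda>n. L1_norm M (g0 n)) \<longlonglongrightarrow> 0"
  proof -
    have "(\<lambda>n. \<integral>\<^sup>+u. q u * indicator {u. of_nat n < q u} u \<partial>M) \<longlonglongrightarrow> (\<integral>\<^sup>+u. 0 \<partial>M)"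
    proof (rule nn_integral_dominated_convergence[where w=q])
      show "AE u in M. (\<lambda>n. q u * indicator {u. of_nat n < q u} u) \<longlonglongrightarrow> 0"
        using AE_fin
      proof eventually_elim
        case (elim u)
        then obtain k :: nat where k: "q u \<le> of_nat k"
          using ennreal_Ex_less_of_nat[of "q u"] by (auto simp: less_top intro: less_imp_le)
        have "q u * indicator {u. of_nat n < q u} u = 0" if "k \<le> n" for n
        proof -
          have "(of_nat k :: ennreal) \<le> of_nat n" using that by simp
          with k have "q u \<le> of_nat n" by (rule order_trans)
          then show ?thesis by (simp add: indicator_def not_less)
        qed
        then show ?case by (intro tendsto_eventually) (auto simp: eventually_sequentially)
      qed
    qed (use q_int in \<open>auto simp: indicator_def\<close>)
    then show ?thesis by (simp add: L1_norm_def g0_abs)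
  qed
  have K_le: "K_functional M (L1_norm M) (Linf_down_norm M \<A>) f 0 \<le> L1_norm M (g0 n)" for n
  proof -
    obtain c where c: "0 \<le> c" "Linf_down_norm M \<A> f1 = ennreal c"
      using decompositionsD(4)[OF dec] by (cases "Linf_down_norm M \<A> f1") auto
    have "Linf_down_norm M \<A> (g1 n) \<le> ennreal (real n + c)"
    proof (rule Linf_down_norm_le[OF sf core])
      fix A assume A: "A \<in> \<A>"
      have [measurable]: "A \<in> sets M" using full_ordered_coreD(1)[OF core] A by blast
      have "(\<integral>\<^sup>+u. e2ennreal \<bar>g1 n u\<bar> * indicator A u \<partial>M)
          \<le> (\<integral>\<^sup>+u. of_nat n * indicator A u + e2ennreal \<bar>f1 u\<bar> * indicator A u \<partial>M)"
      proof (intro nn_integral_mono)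
        fix u
        have "e2ennreal \<bar>g1 n u\<bar> \<le> of_nat n + e2ennreal \<bar>f1 u\<bar>"
        proof (cases "of_nat n < q u")
          case False
          then have "e2ennreal \<bar>f0 u + f1 u\<bar> \<le> of_nat n + e2ennreal \<bar>f1 u\<bar>"
            using e2ennreal_abs_add_le[of "f0 u" "f1 u"] unfolding q_def
            by (meson add_right_mono not_less order_trans)
          then show ?thesis using False by (simp add: g1_def)
        qed (simp add: g1_def)
        then show "e2ennreal \<bar>g1 n u\<bar> * indicator A u \<le> of_nat n * indicator A u + e2ennreal \<bar>f1 u\<bar> * indicator A u"
          by (auto simp: indicator_def)
      qed
      also have "\<dots> = of_nat n * emeasure M A + (\<integral>\<^sup>+u. e2ennreal \<bar>f1 u\<bar> * indicator A u \<partial>M)"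
        by (subst nn_integral_add) (auto simp: nn_integral_cmult)
      also have "(\<integral>\<^sup>+u. e2ennreal \<bar>f1 u\<bar> * indicator A u \<partial>M) \<le> emeasure M A * ennreal c"
        using nn_integral_core_le_Linf_down_norm[OF core A, of f1] c(2) by simp
      also have "of_nat n * emeasure M A + emeasure M A * ennreal c = ennreal (real n + c) * emeasure M A"
        using c(1) by (simp add: ennreal_of_nat_eq_real_of_nat distrib_left distrib_right mult.commute)
      finally show "(\<integral>\<^sup>+u. e2ennreal \<bar>g1 n u\<bar> * indicator A u \<partial>M) \<le> ennreal (real n + c) * emeasure M A"
        by (simp add: add_left_mono)
    qed measurable
    then have N1: "Linf_down_norm M \<A> (g1 n) < \<infinity>" by (rule le_less_trans) simp
    have "L1_norm M (g0 n) \<le> (\<integral>\<^sup>+u. q u \<partial>M)"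
      unfolding L1_norm_def g0_abs by (intro nn_integral_mono) (auto simp: indicator_def)
    then have N0: "L1_norm M (g0 n) < \<infinity>" using q_int by (rule le_less_trans)
    have "(g0 n, g1 n) \<in> decompositions M (L1_norm M) (Linf_down_norm M \<A>) f"
      using N0 N1 decompositionsD(5)[OF dec]
      by (auto simp: decompositions_def norm_space_def g0_def g1_def elim!: eventually_mono)
    then have "K_functional M (L1_norm M) (Linf_down_norm M \<A>) f 0
        \<le> L1_norm M (g0 n) + ennreal 0 * Linf_down_norm M \<A> (g1 n)"
      unfolding K_functional_def by (intro INF_lower2) auto
    then show ?thesis by simp
  qed
  have "K_functional M (L1_norm M) (Linf_down_norm M \<A>) f 0 \<le> 0"
    using lim K_le by (intro LIMSEQ_le_const) auto
  then show ?thesis by simp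
qed

text \<open>The converse of the lower bound for the \<open>K\<close>-functional. Let \<open>a + b x\<close> be a supporting line of \<open>w\<close>
  at \<open>t > 0\<close>. Then \<open>\<bar>g\<bar>\<close> can be split between the capacities \<open>a\<close> and \<open>b x\<close>. The first part has
  \<open>L\<^sup>1\<close> norm at most \<open>a\<close>, the second has norm at most \<open>b\<close>, and \<open>a + t b = w t\<close>. At \<open>t = 0\<close> the
  \<open>K\<close>-functional vanishes.\<close>

lemma K_functional_le_concave:
  assumes sf: "sigma_finite_measure M" and core: "full_ordered_core M \<A>"
    and g[measurable]: "g \<in> borel_measurable M"
    and conc: "concave_on {0..} w" and nonneg: "\<And>x. 0 \<le> x \<Longrightarrow> 0 \<le> w x"
    and le: "\<And>A. A \<in> \<A> \<Longrightarrow>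
      (\<integral>\<^sup>+u. e2ennreal \<bar>g u\<bar> * indicator A u \<partial>M) \<le> ennreal (w (measure M A))"
  shows "g \<in> sum_space M (L1_norm M) (Linf_down_norm M \<A>)"
    and "\<And>t. 0 \<le> t \<Longrightarrow> K_functional M (L1_norm M) (Linf_down_norm M \<A>) g t \<le> ennreal (w t)"
proof -
  have *: "decompositions M (L1_norm M) (Linf_down_norm M \<A>) g \<noteq> {} \<and>
      K_functional M (L1_norm M) (Linf_down_norm M \<A>) g t \<le> ennreal (w t)" if t: "0 < t" for t
  proof -
    obtain a b where ab: "0 \<le> a" "0 \<le> b" "a + b * t = w t" "\<And>x. 0 \<le> x \<Longrightarrow> w x \<le> a + b * x"
      using concave_nonneg_supporting_line[OF conc nonneg t] by blast
    define q where "q u = e2ennreal \<bar>g u\<bar>" for u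
    have q[measurable]: "q \<in> borel_measurable M" unfolding q_def by measurable
    have q_le: "(\<integral>\<^sup>+u. q u * indicator A u \<partial>M) \<le> ennreal (a + b * measure M A)" if "A \<in> \<A>" for A
      using le[OF that] ennreal_leI[OF ab(4)[of "measure M A"]] unfolding q_def by (auto intro: order_trans)
    obtain \<theta> :: "'a \<Rightarrow> real" where [measurable]: "\<theta> \<in> borel_measurable M"
      and \<theta>01: "\<And>u. 0 \<le> \<theta> u" "\<And>u. \<theta> u \<le> 1"
      and \<theta>0: "\<And>A. A \<in> \<A> \<Longrightarrow> (\<integral>\<^sup>+u. ennreal (\<theta> u) * q u * indicator A u \<partial>M) \<le> ennreal a"
      and \<theta>1: "\<And>A. A \<in> \<A> \<Longrightarrow>
        (\<integral>\<^sup>+u. ennreal (1 - \<theta> u) * q u * indicator A u \<partial>M) \<le> ennreal (b * measure M A)"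
      by (rule split_between_capacities[OF core q, of "\<lambda>_. a" "\<lambda>x. b * x"])
        (use ab q_le in \<open>auto intro: mult_left_mono\<close>)
    define g0 where "g0 u = ereal (\<theta> u) * g u" for u
    define g1 where "g1 u = ereal (1 - \<theta> u) * g u" for u
    have [measurable]: "g0 \<in> borel_measurable M" "g1 \<in> borel_measurable M"
      unfolding g0_def g1_def by measurable
    have g0_abs: "e2ennreal \<bar>g0 u\<bar> = ennreal (\<theta> u) * q u" for u
      using \<theta>01[of u] by (simp add: g0_def q_def e2ennreal_abs_cmult)
    have g1_abs: "e2ennreal \<bar>g1 u\<bar> = ennreal (1 - \<theta> u) * q u" for u
      using \<theta>01[of u] by (simp add: g1_def q_def e2ennreal_abs_cmult)
    have sum: "g0 u + g1 u = g u" for u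
    proof -
      have "g0 u + g1 u = (ereal (\<theta> u) + ereal (1 - \<theta> u)) * g u"
        unfolding g0_def g1_def using \<theta>01[of u] by (intro ereal_left_distrib[symmetric]) auto
      then show ?thesis by (simp add: one_ereal_def[symmetric])
    qed
    have N0: "L1_norm M g0 \<le> ennreal a"
    proof -
      obtain B :: "nat \<Rightarrow> 'a set" where BA: "\<And>n. B n \<in> \<A>" and UB: "(\<Union>n. B n) = space M"
        by (rule full_ordered_core_enumerate[OF core]) blast
      have BM: "B n \<in> sets M" for n using full_ordered_coreD(1)[OF core] BA by blast
      let ?D = "density M (\<lambda>u. ennreal (\<theta> u) * q u)"
      have "emeasure ?D (\<Union>n. B n) \<le> ennreal a"
      proof (rule chain_UN_emeasure_le)
        show "B m \<subseteq> B n \<or> B n \<subseteq> B m" for m n by (rule full_ordered_coreD(3)[OF core BA BA])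
        show "emeasure ?D (B n) \<le> ennreal a" for n
          using \<theta>0[OF BA[of n]] BM[of n] by (simp add: emeasure_density)
      qed (use BM in simp)
      also have "emeasure ?D (\<Union>n. B n) = L1_norm M g0"
        unfolding UB L1_norm_def g0_abs by (subst emeasure_density) (auto intro!: nn_integral_cong)
      finally show ?thesis .
    qed
    have N1: "Linf_down_norm M \<A> g1 \<le> ennreal b"
    proof (rule Linf_down_norm_le[OF sf core])
      fix A assume A: "A \<in> \<A>"
      show "(\<integral>\<^sup>+u. e2ennreal \<bar>g1 u\<bar> * indicator A u \<partial>M) \<le> ennreal b * emeasure M A"
        using \<theta>1[OF A] ab(2) full_ordered_coreD(4)[OF core A]
        by (simp add: g1_abs emeasure_eq_ennreal_measure ennreal_mult)
    qed measurable
    have dec: "(g0, g1) \<in> decompositions M (L1_norm M) (Linf_down_norm M \<A>) g"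
      using le_less_trans[OF N0] le_less_trans[OF N1] sum
      by (simp add: decompositions_def norm_space_def)
    then have "K_functional M (L1_norm M) (Linf_down_norm M \<A>) g t
        \<le> L1_norm M g0 + ennreal t * Linf_down_norm M \<A> g1"
      unfolding K_functional_def by (intro INF_lower2[where i="(g0, g1)"]) auto
    also have "\<dots> \<le> ennreal a + ennreal t * ennreal b"
      using N0 N1 by (intro add_mono mult_left_mono) auto
    also have "\<dots> = ennreal (w t)"
      using ab t by (simp add: ennreal_mult[symmetric] ennreal_plus[symmetric] mult.commute del: ennreal_plus)
    finally show ?thesis using dec by blast
  qed
  show sum: "g \<in> sum_space M (L1_norm M) (Linf_down_norm M \<A>)"
    using *[of 1] g by (simp add: sum_space_def)
  show "K_functional M (L1_norm M) (Linf_down_norm M \<A>) g t \<le> ennreal (w t)" if "0 \<le> t" for t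
    using *[of t] K_functional_zero[OF sf core sum] that by (cases "t = 0") auto
qed

section \<open>Divisibility\<close>

text \<open>Splitting off one capacity at a time: \<open>R n\<close> is the proportion of \<open>q\<close> that remains for the capacities
  from index \<open>n\<close> on, and \<open>R n - R (Suc n)\<close> is the proportion that goes to \<open>\<omega> n\<close>.\<close>

lemma split_between_concave_sequence:
  fixes M :: "'a measure" and q :: "'a \<Rightarrow> ennreal" and \<omega> :: "nat \<Rightarrow> real \<Rightarrow> real"
  assumes core: "full_ordered_core M \<A>" and q[measurable]: "q \<in> borel_measurable M"
    and conc: "\<And>j. concave_on {0..} (\<omega> j)" and nonneg: "\<And>j x. 0 \<le> x \<Longrightarrow> 0 \<le> \<omega> j x"
    and sum: "\<And>x. 0 \<le> x \<Longrightarrow> summable (\<lambda>j. \<omega> j x)"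
    and le: "\<And>A. A \<in> \<A> \<Longrightarrow>
      (\<integral>\<^sup>+u. q u * indicator A u \<partial>M) \<le> ennreal (\<Sum>j. \<omega> j (measure M A))"
  obtains R :: "nat \<Rightarrow> 'a \<Rightarrow> real" where "\<And>n. R n \<in> borel_measurable M" "\<And>u. R 0 u = 1"
    "\<And>n u. 0 \<le> R n u" "\<And>n u. R (Suc n) u \<le> R n u"
    "\<And>n A. A \<in> \<A> \<Longrightarrow> (\<integral>\<^sup>+u. ennreal (R n u) * q u * indicator A u \<partial>M)
      \<le> ennreal (\<Sum>j. \<omega> (j + n) (measure M A))"
    "\<And>n A. A \<in> \<A> \<Longrightarrow> (\<integral>\<^sup>+u. ennreal (R n u - R (Suc n) u) * q u * indicator A u \<partial>M)
      \<le> ennreal (\<omega> n (measure M A))"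
proof -
  define tail where "tail n x = (\<Sum>j. \<omega> (j + n) x)" for n x
  have sum': "summable (\<lambda>j. \<omega> (j + n) x)" if "0 \<le> x" for n x
    using sum[OF that] by (rule summable_ignore_initial_segment)
  have tail_nonneg: "0 \<le> tail n x" if "0 \<le> x" for n x
    unfolding tail_def using sum'[OF that] nonneg[OF that] by (intro suminf_nonneg) auto
  have \<omega>_mono: "\<omega> j x \<le> \<omega> j y" if "0 \<le> x" "x \<le> y" for j x y
    using concave_nonneg_mono[OF conc nonneg that] .
  have tail_mono: "tail n x \<le> tail n y" if "0 \<le> x" "x \<le> y" for n x y
    unfolding tail_def using sum' \<omega>_mono that by (intro suminf_le) auto
  have tail_Suc: "tail n x = \<omega> n x + tail (Suc n) x" if "0 \<le> x" for n x
    using suminf_split_head[OF sum'[OF that, of n]] by (simp add: tail_def)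
  define P where "P n R \<longleftrightarrow> R \<in> borel_measurable M \<and> (n = 0 \<longrightarrow> R = (\<lambda>_. 1)) \<and> (\<forall>u. 0 \<le> R u) \<and>
      (\<forall>A\<in>\<A>. (\<integral>\<^sup>+u. ennreal (R u) * q u * indicator A u \<partial>M) \<le> ennreal (tail n (measure M A)))"
    for n and R :: "'a \<Rightarrow> real"
  define Q where "Q n R R' \<longleftrightarrow> (\<forall>u. R' u \<le> R u) \<and>
      (\<forall>A\<in>\<A>. (\<integral>\<^sup>+u. ennreal (R u - R' u) * q u * indicator A u \<partial>M) \<le> ennreal (\<omega> n (measure M A)))"
    for n and R R' :: "'a \<Rightarrow> real"
  have "\<exists>R. \<forall>n. P n (R n) \<and> Q n (R n) (R (Suc n))"
  proof (rule dependent_nat_choice)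
    show "\<exists>R. P 0 R"
      using le by (intro exI[of _ "\<lambda>_. 1"]) (auto simp: P_def tail_def)
  next
    fix R n assume R: "P n R"
    then have [measurable]: "R \<in> borel_measurable M" and R0: "\<And>u. 0 \<le> R u"
      by (auto simp: P_def)
    have R_le: "(\<integral>\<^sup>+u. ennreal (R u) * q u * indicator A u \<partial>M)
        \<le> ennreal (\<omega> n (measure M A) + tail (Suc n) (measure M A))" if "A \<in> \<A>" for A
      unfolding tail_Suc[OF measure_nonneg, symmetric] using R that by (simp add: P_def)
    have Rq: "(\<lambda>u. ennreal (R u) * q u) \<in> borel_measurable M" by measurable
    obtain \<theta> :: "'a \<Rightarrow> real" where [measurable]: "\<theta> \<in> borel_measurable M"
      and \<theta>01: "\<And>u. 0 \<le> \<theta> u" "\<And>u. \<theta> u \<le> 1"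
      and \<theta>0: "\<And>A. A \<in> \<A> \<Longrightarrow>
        (\<integral>\<^sup>+u. ennreal (\<theta> u) * (ennreal (R u) * q u) * indicator A u \<partial>M) \<le> ennreal (\<omega> n (measure M A))"
      and \<theta>1: "\<And>A. A \<in> \<A> \<Longrightarrow>
        (\<integral>\<^sup>+u. ennreal (1 - \<theta> u) * (ennreal (R u) * q u) * indicator A u \<partial>M)
          \<le> ennreal (tail (Suc n) (measure M A))"
      by (rule split_between_capacities[OF core Rq \<omega>_mono nonneg tail_mono tail_nonneg R_le]) blast+
    define R' where "R' u = (1 - \<theta> u) * R u" for u
    have "R' \<in> borel_measurable M" unfolding R'_def by measurable
    have diff: "R u - R' u = \<theta> u * R u" for u by (simp add: R'_def algebra_simps)
    have "P (Suc n) R'"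
      unfolding P_def
    proof (intro conjI ballI allI)
      show "0 \<le> R' u" for u using \<theta>01[of u] R0[of u] by (simp add: R'_def)
      show "(\<integral>\<^sup>+u. ennreal (R' u) * q u * indicator A u \<partial>M) \<le> ennreal (tail (Suc n) (measure M A))"
        if "A \<in> \<A>" for A
        using \<theta>1[OF that] \<theta>01 R0 by (simp add: R'_def ennreal_mult mult.assoc)
    qed (use \<open>R' \<in> borel_measurable M\<close> in simp_all)
    moreover have "Q n R R'"
      unfolding Q_def
    proof (intro conjI ballI allI)
      show "R' u \<le> R u" for u using diff[of u] \<theta>01[of u] R0[of u] by (smt (verit) mult_nonneg_nonneg)
      show "(\<integral>\<^sup>+u. ennreal (R u - R' u) * q u * indicator A u \<partial>M) \<le> ennreal (\<omega> n (measure M A))"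
        if "A \<in> \<A>" for A
        unfolding diff using \<theta>0[OF that] \<theta>01 R0 by (simp add: ennreal_mult mult.assoc)
    qed
    ultimately show "\<exists>R'. P (Suc n) R' \<and> Q n R R'" by blast
  qed
  then obtain R where R: "\<And>n. P n (R n)" "\<And>n. Q n (R n) (R (Suc n))" by blast
  show thesis
    by (rule that[of R]) (use R in \<open>simp_all add: P_def Q_def tail_def\<close>)
qed

theorem lemma8p8:
  fixes M :: "'a measure" and \<A> :: "'a set set"
  assumes "sigma_finite_measure M"
    and "full_ordered_core M \<A>"
  shows "divisibility_constant_one M (L1_norm M) (Linf_down_norm M \<A>)"
  unfolding divisibility_constant_one_def
proof (intro ballI allI impI)
  note sf = assms(1) and core = assms(2)
  let ?N0 = "L1_norm M" and ?N1 = "Linf_down_norm M \<A>"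
  fix f and \<omega> :: "nat \<Rightarrow> real \<Rightarrow> real"
  assume f: "f \<in> sum_space M ?N0 ?N1"
    and \<omega>: "\<forall>j. concave_on {0..} (\<omega> j) \<and> (\<forall>t\<ge>0. 0 \<le> \<omega> j t)"
    and sum1: "summable (\<lambda>j. \<omega> j 1)"
    and K: "\<forall>t\<ge>0. K_functional M ?N0 ?N1 f t \<le> ennreal (\<Sum>j. \<omega> j t)"
  have conc: "concave_on {0..} (\<omega> j)" and nonneg: "0 \<le> x \<Longrightarrow> 0 \<le> \<omega> j x" for j x
    using \<omega> by auto
  have sum: "summable (\<lambda>j. \<omega> j x)" if "0 \<le> x" for x
    by (rule summable_concave_nonneg[OF conc nonneg sum1 that])
  have f_meas[measurable]: "f \<in> borel_measurable M" using f by (simp add: sum_space_def)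
  define q where "q u = e2ennreal \<bar>f u\<bar>" for u
  have q[measurable]: "q \<in> borel_measurable M" unfolding q_def by measurable
  have q_le: "(\<integral>\<^sup>+u. q u * indicator A u \<partial>M) \<le> ennreal (\<Sum>j. \<omega> j (measure M A))" if "A \<in> \<A>" for A
    unfolding q_def
    by (rule order_trans[OF nn_integral_core_le_K_functional[OF core that]]) (use K in simp)
  obtain R :: "nat \<Rightarrow> 'a \<Rightarrow> real" where [measurable]: "\<And>n. R n \<in> borel_measurable M"
    and R_0: "\<And>u. R 0 u = 1" and R_nonneg: "\<And>n u. 0 \<le> R n u" and R_dec: "\<And>n u. R (Suc n) u \<le> R n u"
    and R_tail: "\<And>n A. A \<in> \<A> \<Longrightarrow> (\<integral>\<^sup>+u. ennreal (R n u) * q u * indicator A u \<partial>M)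
      \<le> ennreal (\<Sum>j. \<omega> (j + n) (measure M A))"
    and R_diff: "\<And>n A. A \<in> \<A> \<Longrightarrow> (\<integral>\<^sup>+u. ennreal (R n u - R (Suc n) u) * q u * indicator A u \<partial>M)
      \<le> ennreal (\<omega> n (measure M A))"
    by (rule split_between_concave_sequence[OF core q conc nonneg sum q_le]) blast+
  \<comment> \<open>Infinite values of \<open>f\<close> cause no trouble: by \<open>AE_fin\<close> below they occur on a null set only.\<close>
  define F where "F n u = ereal (R n u - R (Suc n) u) * f u" for n u
  have [measurable]: "F n \<in> borel_measurable M" for n unfolding F_def by measurable
  have F_abs: "e2ennreal \<bar>F n u\<bar> = ennreal (R n u - R (Suc n) u) * q u" for n u
    unfolding F_def q_def using R_dec[of n u] by (intro e2ennreal_abs_cmult) simp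
  have F: "F n \<in> sum_space M ?N0 ?N1"
    "0 \<le> t \<Longrightarrow> K_functional M ?N0 ?N1 (F n) t \<le> ennreal (\<omega> n t)" for n t
    using K_functional_le_concave[OF sf core \<open>F n \<in> borel_measurable M\<close> conc[of n] nonneg] R_diff
    by (simp_all add: F_abs)
  have AE_fin: "AE u in M. q u < \<infinity>"
    by (rule AE_finite_if_core_integrals_finite[OF core q])
      (use le_less_trans[OF q_le ennreal_less_top] in simp)
  have rest: "AE u in M. f u - (\<Sum>j<n. F j u) = ereal (R n u) * f u" for n
    using AE_fin
  proof eventually_elim
    case (elim u)
    then obtain x where x: "f u = ereal x" by (cases "f u") (auto simp: q_def)
    have "(\<Sum>j<n. F j u) = ereal (\<Sum>j<n. (R j u - R (Suc j) u) * x)"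
      by (simp add: F_def x)
    also have "(\<Sum>j<n. (R j u - R (Suc j) u) * x) = (1 - R n u) * x"
      using sum_lessThan_telescope'[of "\<lambda>j. R j u" n] by (simp add: sum_distrib_right[symmetric] R_0)
    finally show ?case by (simp add: x algebra_simps)
  qed
  \<comment> \<open>The remainder \<open>R n * f\<close> obeys the bound given by the tail of the series, which is itself concave.\<close>
  have tail_bound: "sum_norm M ?N0 ?N1 (\<lambda>u. f u - (\<Sum>j<n. F j u)) \<le> ennreal (\<Sum>j. \<omega> (j + n) 1)" for n
  proof -
    have sum_n: "summable (\<lambda>j. \<omega> (j + n) x)" if "0 \<le> x" for x
      using sum[OF that] by (rule summable_ignore_initial_segment)
    have "K_functional M ?N0 ?N1 (\<lambda>u. ereal (R n u) * f u) 1 \<le> ennreal (\<Sum>j. \<omega> (j + n) 1)"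
    proof (rule K_functional_le_concave(2)[OF sf core, where w="\<lambda>x. \<Sum>j. \<omega> (j + n) x"])
      show "concave_on {0..} (\<lambda>x. \<Sum>j. \<omega> (j + n) x)"
        using conc sum_n by (intro concave_on_suminf) auto
      show "0 \<le> (\<Sum>j. \<omega> (j + n) x)" if "0 \<le> x" for x
        using sum_n[OF that] nonneg[OF that] by (intro suminf_nonneg) auto
      show "(\<integral>\<^sup>+u. e2ennreal \<bar>ereal (R n u) * f u\<bar> * indicator A u \<partial>M)
          \<le> ennreal (\<Sum>j. \<omega> (j + n) (measure M A))" if "A \<in> \<A>" for A
        using R_tail[OF that, of n] R_nonneg by (simp add: e2ennreal_abs_cmult q_def)
    qed simp_all
    then show ?thesis
      unfolding sum_norm_def K_functional_cong_AE[OF rest] .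
  qed
  have "(\<lambda>n. sum_norm M ?N0 ?N1 (\<lambda>u. f u - (\<Sum>j<n. F j u))) \<longlonglongrightarrow> 0"
  proof (rule tendsto_sandwich[OF _ _ tendsto_const])
    have "(\<lambda>n. (\<Sum>j. \<omega> j 1) - (\<Sum>j<n. \<omega> j 1)) \<longlonglongrightarrow> (\<Sum>j. \<omega> j 1) - (\<Sum>j. \<omega> j 1)"
      by (intro tendsto_intros summable_LIMSEQ sum1)
    then have "(\<lambda>n. ennreal (\<Sum>j. \<omega> (j + n) 1)) \<longlonglongrightarrow> ennreal 0"
      using suminf_minus_initial_segment[OF sum1] by (intro tendsto_ennrealI) simp
    then show "(\<lambda>n. ennreal (\<Sum>j. \<omega> (j + n) 1)) \<longlonglongrightarrow> 0" by simp
  qed (use tail_bound in auto)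
  then show "\<exists>F. (\<forall>j. F j \<in> sum_space M ?N0 ?N1) \<and>
      (\<forall>j. \<forall>t\<ge>0. K_functional M ?N0 ?N1 (F j) t \<le> ennreal (\<omega> j t)) \<and>
      (\<lambda>n. sum_norm M ?N0 ?N1 (\<lambda>u. f u - (\<Sum>j<n. F j u))) \<longlonglongrightarrow> 0"
    using F by blast
qed

end
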